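(* For each $\mathfrak n\in\{ck,cs,cs^\ast,cp,cn,0\}$, the class of $\mathfrak n$-$\sigma$-spaces is closed under taking subspaces, topological sums and countable (Tychonoff) products.
   Context: All topological spaces are Hausdorff. Let $\mathcal N$ be a family of subsets of a space $X$ and $x\in X$. $\mathcal N$ is, at $x$: - a $0$-network (simply, a network) if for each neighborhood $O_x$ of $x$ there is $N\in\mathcal N$ with $x\in N\subset O_x$; - a $cn$-network if for each neighborhood $O_x$ of $x$ the set $\bigcup\{N\in\mathcal N: x\in N\subset O_x\}$ is a neighborhood of $x$; - a $ck$-network if for any neighborhood $O_x$ of $x$ there is a neighborhood $U_x$ of $x$ such that for each compact $K\subset U_x$ there is a finite $\mathcal F\subset\mathcal N$ with $x\in\bigcap\mathcal F$ and $K\subset\bigcup\mathcal F\subset O_x$; - a $cs$-network if for each sequence $(x_n)_{n\in\mathbb N}$ in $X$ converging to $x$ and each neighborhood $O_x$ of $x$ there are $N\in\mathcal N$ and $k\in\mathbb N$ with $\{x\}\cup\{x_n:n\ge k\}\subset N\subset O_x$; - a $cs^\ast$-network if for each sequence $(x_n)_{n\in\mathbb N}$ in $X$ converging to $x$ and each neighborhood $O_x$ of $x$ there is $N\in\mathcal N$ with $x\in N\subset O_x$ and $\{n: x_n\in N\}$ infinite; - a $cp$-network if either $x$ is isolated in $X$ and $\{x\}\in\mathcal N$, or for each $A\subset X$ with $x\in\overline A\setminus A$ and each neighborhood $O_x$ of $x$ there is $N\in\mathcal N$ with $x\in N\subset O_x$ and $N\cap A$ infinite. $\mathcal N$ is an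 $\mathfrak n$-network in $X$ if it is an $\mathfrak n$-network at each point of $X$. A family is $\sigma$-locally finite if it is a countable union of locally finite families. $X$ is an $\mathfrak n$-$\sigma$-space if it is regular and has a $\sigma$-locally finite $\mathfrak n$-network. In particular, $cp$-$\sigma$-spaces are called $\mathfrak{P}$-spaces, $ck$-$\sigma$-spaces strict $\aleph$-spaces, $cn$-$\sigma$-spaces strict $\sigma$-spaces, and $0$-$\sigma$-spaces $\sigma$-spaces. *)

theory Defs
  imports "HOL-Analysis.Analysis"
begin

text \<open>Neighbourhoods are not required to be open.\<close>

definition nbhd_of :: "'a topology \<Rightarrow> 'a \<Rightarrow> 'a set \<Rightarrow> bool" where
  "nbhd_of X x V \<longleftrightarrow> V \<subseteq> topspace X \<and> x \<in> X interior_of V"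

definition network_at :: "'a topology \<Rightarrow> 'a set set \<Rightarrow> 'a \<Rightarrow> bool" where
  "network_at X \<N> x \<longleftrightarrow>
     (\<forall>V. nbhd_of X x V \<longrightarrow> (\<exists>N\<in>\<N>. x \<in> N \<and> N \<subseteq> V))"

definition cn_network_at :: "'a topology \<Rightarrow> 'a set set \<Rightarrow> 'a \<Rightarrow> bool" where
  "cn_network_at X \<N> x \<longleftrightarrow>
     (\<forall>V. nbhd_of X x V \<longrightarrow> nbhd_of X x (\<Union>{N \<in> \<N>. x \<in> N \<and> N \<subseteq> V}))"

definition ck_network_at :: "'a topology \<Rightarrow> 'a set set \<Rightarrow> 'a \<Rightarrow> bool" where
  "ck_network_at X \<N> x \<longleftrightarrow>
     (\<forall>V. nbhd_of X x V \<longrightarrow>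
       (\<exists>U. nbhd_of X x U \<and>
         (\<forall>K. compactin X K \<and> K \<subseteq> U \<longrightarrow>
           (\<exists>\<F>. finite \<F> \<and> \<F> \<subseteq> \<N> \<and> x \<in> \<Inter>\<F> \<and> K \<subseteq> \<Union>\<F> \<and> \<Union>\<F> \<subseteq> V))))"

definition cs_network_at :: "'a topology \<Rightarrow> 'a set set \<Rightarrow> 'a \<Rightarrow> bool" where
  "cs_network_at X \<N> x \<longleftrightarrow>
     (\<forall>s :: nat \<Rightarrow> 'a. \<forall>V.
       range s \<subseteq> topspace X \<and> limitin X s x sequentially \<and> nbhd_of X x V \<longrightarrow>
         (\<exists>N\<in>\<N>. \<exists>k. {x} \<union> {s n |n. n \<ge> k} \<subseteq> N \<and> N \<subseteq> V))"

definition cs_star_network_at :: "'a topology \<Rightarrow> 'a set set \<Rightarrow> 'a \<Rightarrow> bool" where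
  "cs_star_network_at X \<N> x \<longleftrightarrow>
     (\<forall>s :: nat \<Rightarrow> 'a. \<forall>V.
       range s \<subseteq> topspace X \<and> limitin X s x sequentially \<and> nbhd_of X x V \<longrightarrow>
         (\<exists>N\<in>\<N>. x \<in> N \<and> N \<subseteq> V \<and> infinite {n. s n \<in> N}))"

text \<open>
  The two alternatives of a \<open>cp\<close>-network are exclusive: the first is for isolated points,
  the second for the other points.  At an isolated point no set \<open>A\<close> satisfies
  \<open>x \<in> X closure_of A - A\<close>, so an inclusive disjunction would make the requirement
  \<open>{x} \<in> \<N>\<close> void.
\<close>

definition cp_network_at :: "'a topology \<Rightarrow> 'a set set \<Rightarrow> 'a \<Rightarrow> bool" where
  "cp_network_at X \<N> x \<longleftrightarrow>
     (openin X {x} \<and> {x} \<in> \<N>) \<or>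
     (\<not> openin X {x} \<and>
      (\<forall>A V. A \<subseteq> topspace X \<and> x \<in> X closure_of A - A \<and> nbhd_of X x V \<longrightarrow>
         (\<exists>N\<in>\<N>. x \<in> N \<and> N \<subseteq> V \<and> infinite (N \<inter> A))))"

datatype network_kind = CK | CS | CS_star | CP | CN | Zero

fun kind_network_at :: "network_kind \<Rightarrow> 'a topology \<Rightarrow> 'a set set \<Rightarrow> 'a \<Rightarrow> bool" where
  "kind_network_at CK = ck_network_at"
| "kind_network_at CS = cs_network_at"
| "kind_network_at CS_star = cs_star_network_at"
| "kind_network_at CP = cp_network_at"
| "kind_network_at CN = cn_network_at"
| "kind_network_at Zero = network_at"

definition kind_network_in :: "network_kind \<Rightarrow> 'a topology \<Rightarrow> 'a set set \<Rightarrow> bool" where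
  "kind_network_in k X \<N> \<longleftrightarrow>
     \<N> \<subseteq> Pow (topspace X) \<and> (\<forall>x\<in>topspace X. kind_network_at k X \<N> x)"

definition sigma_locally_finite_in :: "'a topology \<Rightarrow> 'a set set \<Rightarrow> bool" where
  "sigma_locally_finite_in X \<N> \<longleftrightarrow>
     (\<exists>\<A> :: nat \<Rightarrow> 'a set set. (\<forall>n. locally_finite_in X (\<A> n)) \<and> \<N> = (\<Union>n. \<A> n))"

text \<open>
  All spaces are assumed Hausdorff; \<^const>\<open>regular_space\<close> does not include any
  \<open>T\<^sub>1\<close> axiom, so this is stated separately.
\<close>

definition kind_sigma_space :: "network_kind \<Rightarrow> 'a topology \<Rightarrow> bool" where
  "kind_sigma_space k X \<longleftrightarrow>
     Hausdorff_space X \<and> regular_space X \<and>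
     (\<exists>\<N>. sigma_locally_finite_in X \<N> \<and> kind_network_in k X \<N>)"

end

theory Submission
  imports Defs
begin

text \<open>
  A subspace is given the traces of the members of a network, a sum the images of the members under
  the injections, and a product the cylinders over finitely many members.  For
  \<open>cp\<close>-networks two points need care.  A point that becomes isolated in a subspace
  gets its singleton as the trace of a small member of the network.  In a product, one uses that a
  \<open>\<sigma>\<close>-locally finite family is countable at each point, so that the members of a
  factor's network containing the given coordinate can be enumerated; a set accumulating at the
  point splits into finitely many pieces according to the coordinate that enters its enumeration
  last, and the projection of a piece still accumulating at the point contradicts the
  \<open>cp\<close>-network property of that factor.
\<close>

text \<open>The obstacle is that a product needs one cylinder whose sides work at finitely many
  coordinates simultaneously. For sequences, tails can be intersected and subsequences still
  converge, so the coordinates can be treated one after another. For \<open>cp\<close>-networks this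
  fails: if a side at one coordinate captures infinitely many points of \<open>A\<close>, those
  points need not accumulate at \<open>x\<close>, so the next coordinate cannot be treated within
  them; moreover, the projection of \<open>A\<close> may contain \<open>x j\<close>, and then the
  \<open>cp\<close> property of the factor does not apply to it. Ranks answer both points. Every
  candidate contains \<open>x j\<close>, so \<open>x j\<close> has rank 0 and a piece with positive
  rank at \<open>j\<close> has a projection avoiding \<open>x j\<close>. If that rank is also the
  largest one, bounding it bounds all ranks, so that a single member in a single factor controls
  every coordinate. Ranks make sense only for points covered by candidates; cutting \<open>A\<close>
  down to these keeps accumulation because a \<open>cp\<close>-network is a
  \<open>cn\<close>-network.\<close>

section \<open>Neighbourhoods, closures and isolated points\<close>

lemma nbhd_of_alt:
  "nbhd_of X x V \<longleftrightarrow> V \<subseteq> topspace X \<and> (\<exists>U. openin X U \<and> x \<in> U \<and> U \<subseteq> V)"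
  by (auto simp: nbhd_of_def interior_of_def)

lemma openin_imp_nbhd_of: "openin X U \<Longrightarrow> x \<in> U \<Longrightarrow> nbhd_of X x U"
  using openin_subset by (auto simp: nbhd_of_alt)

lemma nbhd_of_mono: "nbhd_of X x U \<Longrightarrow> U \<subseteq> V \<Longrightarrow> V \<subseteq> topspace X \<Longrightarrow> nbhd_of X x V"
  unfolding nbhd_of_alt by blast

lemma nbhd_of_subtopologyE:
  assumes "nbhd_of (subtopology X S) x V"
  obtains U where "nbhd_of X x U" "U \<inter> S \<subseteq> V"
proof -
  obtain U where "openin (subtopology X S) U" "x \<in> U" "U \<subseteq> V"
    using assms unfolding nbhd_of_alt by blast
  then obtain T where "openin X T" "U = T \<inter> S"
    unfolding openin_subtopology by blast
  with \<open>x \<in> U\<close> \<open>U \<subseteq> V\<close> have "nbhd_of X x T" "T \<inter> S \<subseteq> V"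
    by (simp_all add: openin_imp_nbhd_of)
  then show ?thesis
    by (rule that)
qed

lemma nbhd_of_subtopologyI:
  assumes "nbhd_of X x U" "x \<in> S"
  shows "nbhd_of (subtopology X S) x (U \<inter> S)"
proof -
  obtain T where T: "openin X T" "x \<in> T" "T \<subseteq> U" and "U \<subseteq> topspace X"
    using assms(1) unfolding nbhd_of_alt by blast
  show ?thesis
  proof (rule nbhd_of_mono)
    show "nbhd_of (subtopology X S) x (T \<inter> S)"
      using T assms(2) by (simp add: openin_imp_nbhd_of openin_subtopology_Int)
  qed (use T \<open>U \<subseteq> topspace X\<close> in auto)
qed

text \<open>In a T1 space the finite part \<open>A \<inter> D\<close> (within the space) is closed,
  so it adds only points of \<open>A\<close> to the closure; since \<open>x \<notin> A\<close>, the
  rest of \<open>A\<close> must already accumulate at \<open>x\<close>.\<close>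

lemma closure_of_diff_finite:
  assumes "t1_space X" "finite D" "x \<in> X closure_of A - A"
  shows "x \<in> X closure_of (A - D)"
proof -
  have "closedin X (A \<inter> D \<inter> topspace X)"
    using assms(1,2) by (simp add: t1_space_closedin_finite)
  moreover have "X closure_of A = X closure_of (A \<inter> D \<inter> topspace X) \<union> X closure_of (A - D)"
    by (metis Int_Diff_Un closure_of_Un closure_of_restrict inf_commute)
  ultimately show ?thesis
    using assms(3) by (auto simp: closure_of_closedin)
qed

text \<open>Lets the complement of \<open>x\<close> serve as test set in the \<open>cp\<close>
  condition, which is how nonisolated points obtain small members.\<close>

lemma not_openin_singleton_iff:
  assumes "x \<in> topspace X"
  shows "\<not> openin X {x} \<longleftrightarrow> x \<in> X closure_of (topspace X - {x})"
proof
  assume *: "\<not> openin X {x}"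
  have "\<exists>y. y \<in> topspace X - {x} \<and> y \<in> T" if "x \<in> T" "openin X T" for T
    using that * openin_subset[of X T] by (cases "T = {x}") auto
  then show "x \<in> X closure_of (topspace X - {x})"
    using assms by (auto simp: in_closure_of)
qed (auto simp: in_closure_of)

section \<open>Using the network properties, and what a \<open>cp\<close>-network implies\<close>

lemma ck_network_atE:
  assumes "ck_network_at X \<N> x" "nbhd_of X x V"
  obtains U where "nbhd_of X x U"
    "\<And>K. compactin X K \<Longrightarrow> K \<subseteq> U \<Longrightarrow>
      \<exists>\<F>. finite \<F> \<and> \<F> \<subseteq> \<N> \<and> x \<in> \<Inter>\<F> \<and> K \<subseteq> \<Union>\<F> \<and> \<Union>\<F> \<subseteq> V"
proof -
  have "\<exists>U. nbhd_of X x U \<and> (\<forall>K. compactin X K \<and> K \<subseteq> U \<longrightarrow>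
      (\<exists>\<F>. finite \<F> \<and> \<F> \<subseteq> \<N> \<and> x \<in> \<Inter>\<F> \<and> K \<subseteq> \<Union>\<F> \<and> \<Union>\<F> \<subseteq> V))"
    using assms(1)[unfolded ck_network_at_def, rule_format, OF assms(2)] .
  then show ?thesis
    using that by meson
qed

lemma cs_network_atE:
  assumes "cs_network_at X \<N> x" "range s \<subseteq> topspace X" "limitin X s x sequentially" "nbhd_of X x V"
  obtains N k where "N \<in> \<N>" "x \<in> N" "\<And>n. n \<ge> k \<Longrightarrow> s n \<in> N" "N \<subseteq> V"
proof -
  have "\<exists>N\<in>\<N>. \<exists>k. {x} \<union> {s n |n. n \<ge> k} \<subseteq> N \<and> N \<subseteq> V"
    using assms(1)[unfolded cs_network_at_def, rule_format, of s V] assms(2-4) by simp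
  then show ?thesis
    using that by fast
qed

lemma cs_star_network_atE:
  assumes "cs_star_network_at X \<N> x" "range s \<subseteq> topspace X" "limitin X s x sequentially"
    "nbhd_of X x V"
  obtains N where "N \<in> \<N>" "x \<in> N" "N \<subseteq> V" "infinite {n. s n \<in> N}"
  using assms(1)[unfolded cs_star_network_at_def, rule_format, of s V] assms(2-4) that by auto

text \<open>A set accumulating at \<open>x\<close> from outside rules out that \<open>x\<close> is
  isolated, so only the second alternative of the definition can hold and later uses need no case
  distinction.\<close>

lemma cp_network_at_accumulation:
  assumes "cp_network_at X \<N> x" "A \<subseteq> topspace X" "x \<in> X closure_of A - A" "nbhd_of X x V"
  shows "\<exists>N\<in>\<N>. x \<in> N \<and> N \<subseteq> V \<and> infinite (N \<inter> A)"
proof -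
  have "\<not> openin X {x}"
    using assms(3) by (auto simp: in_closure_of)
  then show ?thesis
    using assms by (auto simp: cp_network_at_def)
qed

lemma cp_network_at_imp_network_at:
  assumes "cp_network_at X \<N> x" "x \<in> topspace X"
  shows "network_at X \<N> x"
  unfolding network_at_def
proof (intro allI impI)
  fix V assume V: "nbhd_of X x V"
  show "\<exists>N\<in>\<N>. x \<in> N \<and> N \<subseteq> V"
  proof (cases "openin X {x}")
    case True
    then show ?thesis
      using assms V by (auto simp: cp_network_at_def nbhd_of_alt)
  next
    case False
    then show ?thesis
      using cp_network_at_accumulation[OF assms(1) _ _ V, of "topspace X - {x}"]
      by (auto simp: not_openin_singleton_iff assms(2))
  qed
qed

text \<open>If the union \<open>W\<close> were not a neighbourhood, its complement would accumulate
  at \<open>x\<close>, which lies in \<open>W\<close>. The \<open>cp\<close> property would then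
  give a member inside \<open>V\<close> meeting that complement, although this member is one of the
  sets forming \<open>W\<close>.\<close>

lemma cp_network_at_imp_cn_network_at:
  assumes "cp_network_at X \<N> x" "x \<in> topspace X"
  shows "cn_network_at X \<N> x"
  unfolding cn_network_at_def
proof (intro allI impI)
  fix V assume V: "nbhd_of X x V"
  define W where "W = \<Union>{N \<in> \<N>. x \<in> N \<and> N \<subseteq> V}"
  have "x \<in> W"
    using cp_network_at_imp_network_at[OF assms] V by (auto simp: network_at_def W_def)
  have "W \<subseteq> V" "V \<subseteq> topspace X"
    using V by (auto simp: W_def nbhd_of_alt)
  have "x \<notin> X closure_of (topspace X - W)"
  proof
    assume "x \<in> X closure_of (topspace X - W)"
    then have "\<exists>N\<in>\<N>. x \<in> N \<and> N \<subseteq> V \<and> infinite (N \<inter> (topspace X - W))"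
      using cp_network_at_accumulation[OF assms(1) _ _ V, of "topspace X - W"] \<open>x \<in> W\<close> by blast
    then obtain N where "N \<in> \<N>" "x \<in> N" "N \<subseteq> V" "infinite (N \<inter> (topspace X - W))"
      by blast
    moreover from this have "N \<inter> (topspace X - W) = {}"
      by (auto simp: W_def)
    ultimately show False
      by simp
  qed
  then have "x \<in> X interior_of W"
    using assms(2) by (simp add: interior_of_closure_of)
  then show "nbhd_of X x W"
    using \<open>W \<subseteq> V\<close> \<open>V \<subseteq> topspace X\<close> by (auto simp: nbhd_of_def)
qed

section \<open>Families that are countable unions of locally finite ones\<close>

lemma sigma_locally_finite_in_UN:
  assumes "countable I" "\<And>i. i \<in> I \<Longrightarrow> locally_finite_in X (\<A> i)"
  shows "sigma_locally_finite_in X (\<Union>i\<in>I. \<A> i)"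
proof (cases "I = {}")
  case True
  then show ?thesis
    unfolding sigma_locally_finite_in_def
    by (intro exI[of _ "\<lambda>_. {}"]) (auto simp: finite_imp_locally_finite_in)
next
  case False
  \<comment> \<open>\<open>from_nat_into\<close> enumerates a nonempty countable set, possibly with
    repetitions; this is why the empty index set was treated apart.\<close>
  then have "(\<Union>i\<in>I. \<A> i) = (\<Union>n. \<A> (from_nat_into I n))"
    by (metis (no_types) assms(1) image_image range_from_nat_into)
  then show ?thesis
    using assms(2) from_nat_into[OF False]
    unfolding sigma_locally_finite_in_def
    by (intro exI[of _ "\<lambda>n. \<A> (from_nat_into I n)"]) auto
qed

text \<open>A locally finite family is finite at each point, since every member through
  \<open>x\<close> meets each neighbourhood of \<open>x\<close>. The whole family may be
  uncountable.\<close>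

lemma sigma_locally_finite_in_countable_at:
  assumes "sigma_locally_finite_in X \<N>" "x \<in> topspace X"
  shows "countable {N \<in> \<N>. x \<in> N}"
proof -
  obtain \<A> :: "nat \<Rightarrow> 'a set set"
    where \<A>: "\<And>n. locally_finite_in X (\<A> n)" "\<N> = (\<Union>n. \<A> n)"
    using assms by (auto simp: sigma_locally_finite_in_def)
  have "finite {N \<in> \<A> n. x \<in> N}" for n
  proof -
    obtain V where "x \<in> V" "finite {U \<in> \<A> n. U \<inter> V \<noteq> {}}"
      using \<A>(1)[of n] assms(2) by (auto simp: locally_finite_in_def)
    then show ?thesis
      by (auto elim: rev_finite_subset)
  qed
  moreover have "{N \<in> \<N>. x \<in> N} = (\<Union>n. {N \<in> \<A> n. x \<in> N})"
    using \<A>(2) by auto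
  ultimately show ?thesis
    by (simp add: countable_finite)
qed

section \<open>Subspaces\<close>

lemma sigma_locally_finite_in_subtopology:
  assumes "sigma_locally_finite_in X \<N>"
  shows "sigma_locally_finite_in (subtopology X S) ((\<lambda>N. N \<inter> S) ` \<N>)"
proof -
  obtain \<A> :: "nat \<Rightarrow> 'a set set"
    where \<A>: "\<And>n. locally_finite_in X (\<A> n)" "\<N> = (\<Union>n. \<A> n)"
    using assms by (auto simp: sigma_locally_finite_in_def)
  \<comment> \<open>Shrinking each member preserves local finiteness in \<open>X\<close>, and the
    shrunken sets lie in \<open>S\<close>, so the property descends to the subspace.\<close>
  have "locally_finite_in (subtopology X S) ((\<lambda>N. N \<inter> S) ` \<A> n)" for n
    by (intro locally_finite_in_subtopology locally_finite_in_refinement \<A>) auto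
  then show ?thesis
    unfolding sigma_locally_finite_in_def \<A>(2)
    by (intro exI[of _ "\<lambda>n. (\<lambda>N. N \<inter> S) ` \<A> n"]) auto
qed

text \<open>Compact sets, convergent sequences and accumulating sets of the subspace keep these
  roles in \<open>X\<close>, so the hypothesis applies to them with a neighbourhood \<open>W\<close>
  whose trace lies in \<open>V\<close>. Only isolation can be gained by passing to the
  subspace.\<close>

lemma kind_network_at_subtopology:
  assumes net: "kind_network_at k X \<N> x" and x: "x \<in> topspace X" "x \<in> S"
  shows "kind_network_at k (subtopology X S) ((\<lambda>N. N \<inter> S) ` \<N>) x"
proof (cases k)
  case CK
  have "\<exists>U. nbhd_of (subtopology X S) x U \<and>
          (\<forall>K. compactin (subtopology X S) K \<and> K \<subseteq> U \<longrightarrow>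
            (\<exists>\<F>. finite \<F> \<and> \<F> \<subseteq> (\<lambda>N. N \<inter> S) ` \<N> \<and> x \<in> \<Inter>\<F> \<and> K \<subseteq> \<Union>\<F> \<and> \<Union>\<F> \<subseteq> V))"
    if V: "nbhd_of (subtopology X S) x V" for V
  proof -
    obtain W where W: "nbhd_of X x W" "W \<inter> S \<subseteq> V"
      using V by (rule nbhd_of_subtopologyE)
    obtain U where "nbhd_of X x U" and U: "\<And>K. compactin X K \<Longrightarrow> K \<subseteq> U \<Longrightarrow>
        \<exists>\<F>. finite \<F> \<and> \<F> \<subseteq> \<N> \<and> x \<in> \<Inter>\<F> \<and> K \<subseteq> \<Union>\<F> \<and> \<Union>\<F> \<subseteq> W"
      using net[unfolded CK kind_network_at.simps] W(1) by (rule ck_network_atE) blast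
    show ?thesis
    proof (intro exI[of _ "U \<inter> S"] conjI allI impI)
      show "nbhd_of (subtopology X S) x (U \<inter> S)"
        using \<open>nbhd_of X x U\<close> x(2) by (rule nbhd_of_subtopologyI)
      fix K assume "compactin (subtopology X S) K \<and> K \<subseteq> U \<inter> S"
      then have "compactin X K" "K \<subseteq> U" "K \<subseteq> S"
        by (auto simp: compactin_subtopology)
      then obtain \<F> where "finite \<F>" "\<F> \<subseteq> \<N>" "x \<in> \<Inter>\<F>" "K \<subseteq> \<Union>\<F>" "\<Union>\<F> \<subseteq> W"
        using U by meson
      note \<F> = this
      have "\<Union>((\<lambda>N. N \<inter> S) ` \<F>) = \<Union>\<F> \<inter> S"
        by auto
      then have "K \<subseteq> \<Union>((\<lambda>N. N \<inter> S) ` \<F>)" "\<Union>((\<lambda>N. N \<inter> S) ` \<F>) \<subseteq> V"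
        using \<F>(4,5) W(2) \<open>K \<subseteq> S\<close> by auto
      moreover have "finite ((\<lambda>N. N \<inter> S) ` \<F>)" "(\<lambda>N. N \<inter> S) ` \<F> \<subseteq> (\<lambda>N. N \<inter> S) ` \<N>"
        "x \<in> \<Inter>((\<lambda>N. N \<inter> S) ` \<F>)"
        using \<F>(1-3) x(2) by auto
      ultimately show "\<exists>\<F>. finite \<F> \<and> \<F> \<subseteq> (\<lambda>N. N \<inter> S) ` \<N> \<and> x \<in> \<Inter>\<F> \<and> K \<subseteq> \<Union>\<F> \<and> \<Union>\<F> \<subseteq> V"
        by blast
    qed
  qed
  then show ?thesis
    by (simp add: CK ck_network_at_def)
next
  case CS
  have "\<exists>N\<in>(\<lambda>N. N \<inter> S) ` \<N>. \<exists>k. {x} \<union> {s n |n. n \<ge> k} \<subseteq> N \<and> N \<subseteq> V"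
    if s: "range s \<subseteq> topspace (subtopology X S)" "limitin (subtopology X S) s x sequentially"
      and V: "nbhd_of (subtopology X S) x V" for s :: "nat \<Rightarrow> 'a" and V
  proof -
    obtain W where W: "nbhd_of X x W" "W \<inter> S \<subseteq> V"
      using V by (rule nbhd_of_subtopologyE)
    have s': "range s \<subseteq> topspace X" "limitin X s x sequentially"
      using s by (auto simp: limitin_subtopology)
    obtain N k where "N \<in> \<N>" "x \<in> N" "\<And>n. n \<ge> k \<Longrightarrow> s n \<in> N" "N \<subseteq> W"
      using net[unfolded CS kind_network_at.simps] s' W(1) by (rule cs_network_atE) blast
    moreover from this have "{x} \<union> {s n |n. n \<ge> k} \<subseteq> N \<inter> S"
      using s(1) x(2) by auto
    ultimately show ?thesis
      using W(2) by blast
  qed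
  then show ?thesis
    by (simp add: CS cs_network_at_def)
next
  case CS_star
  have "\<exists>N\<in>(\<lambda>N. N \<inter> S) ` \<N>. x \<in> N \<and> N \<subseteq> V \<and> infinite {n. s n \<in> N}"
    if s: "range s \<subseteq> topspace (subtopology X S)" "limitin (subtopology X S) s x sequentially"
      and V: "nbhd_of (subtopology X S) x V" for s :: "nat \<Rightarrow> 'a" and V
  proof -
    obtain W where W: "nbhd_of X x W" "W \<inter> S \<subseteq> V"
      using V by (rule nbhd_of_subtopologyE)
    have s': "range s \<subseteq> topspace X" "limitin X s x sequentially"
      using s by (auto simp: limitin_subtopology)
    obtain N where "N \<in> \<N>" "x \<in> N" "N \<subseteq> W" "infinite {n. s n \<in> N}"
      using net[unfolded CS_star kind_network_at.simps] s' W(1) by (rule cs_star_network_atE) blast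
    moreover have "{n. s n \<in> N} = {n. s n \<in> N \<inter> S}"
      using s(1) by auto
    ultimately show ?thesis
      using W(2) x(2) by (intro bexI[of _ "N \<inter> S"]) auto
  qed
  then show ?thesis
    by (simp add: CS_star cs_star_network_at_def)
next
  case CP
  then have cp: "cp_network_at X \<N> x"
    using net by simp
  show ?thesis
  proof (cases "openin (subtopology X S) {x}")
    case True
    then have "nbhd_of (subtopology X S) x {x}"
      by (simp add: openin_imp_nbhd_of)
    then obtain W where W: "nbhd_of X x W" "W \<inter> S \<subseteq> {x}"
      by (rule nbhd_of_subtopologyE)
    then obtain N where "N \<in> \<N>" "x \<in> N" "N \<subseteq> W"
      using cp_network_at_imp_network_at[OF cp x(1)] by (auto simp: network_at_def)
    with W x(2) have "{x} = N \<inter> S" "N \<in> \<N>"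
      by auto
    then show ?thesis
      using True by (simp add: CP cp_network_at_def)
  next
    case False
    have "\<exists>N\<in>(\<lambda>N. N \<inter> S) ` \<N>. x \<in> N \<and> N \<subseteq> V \<and> infinite (N \<inter> A)"
      if A: "A \<subseteq> topspace (subtopology X S)" "x \<in> (subtopology X S) closure_of A - A"
        and V: "nbhd_of (subtopology X S) x V" for A V
    proof -
      obtain W where W: "nbhd_of X x W" "W \<inter> S \<subseteq> V"
        using V by (rule nbhd_of_subtopologyE)
      have "x \<in> X closure_of A - A"
        using A(2) closure_of_subtopology_subset[of X S A] by auto
      moreover have "A \<subseteq> topspace X" "A \<subseteq> S"
        using A(1) by auto
      ultimately obtain N where "N \<in> \<N>" "x \<in> N" "N \<subseteq> W" "infinite (N \<inter> A)"
        using cp_network_at_accumulation[OF cp _ _ W(1)] by blast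
      moreover have "N \<inter> A = N \<inter> S \<inter> A"
        using \<open>A \<subseteq> S\<close> by auto
      ultimately show ?thesis
        using W(2) x(2) by (intro bexI[of _ "N \<inter> S"]) auto
    qed
    then show ?thesis
      using False by (simp add: CP cp_network_at_def)
  qed
next
  case CN
  have "nbhd_of (subtopology X S) x (\<Union>{N \<in> (\<lambda>N. N \<inter> S) ` \<N>. x \<in> N \<and> N \<subseteq> V})"
    if V: "nbhd_of (subtopology X S) x V" for V
  proof -
    obtain W where W: "nbhd_of X x W" "W \<inter> S \<subseteq> V"
      using V by (rule nbhd_of_subtopologyE)
    have "nbhd_of (subtopology X S) x (\<Union>{N \<in> \<N>. x \<in> N \<and> N \<subseteq> W} \<inter> S)"
      using net CN W(1) x(2) by (intro nbhd_of_subtopologyI) (simp_all add: cn_network_at_def)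
    then show ?thesis
    proof (rule nbhd_of_mono)
      show "\<Union>{N \<in> \<N>. x \<in> N \<and> N \<subseteq> W} \<inter> S \<subseteq> \<Union>{N \<in> (\<lambda>N. N \<inter> S) ` \<N>. x \<in> N \<and> N \<subseteq> V}"
        using W(2) x(2) by blast
      show "\<Union>{N \<in> (\<lambda>N. N \<inter> S) ` \<N>. x \<in> N \<and> N \<subseteq> V} \<subseteq> topspace (subtopology X S)"
        using V by (auto simp: nbhd_of_alt)
    qed
  qed
  then show ?thesis
    by (simp add: CN cn_network_at_def)
next
  case Zero
  have "\<exists>N\<in>(\<lambda>N. N \<inter> S) ` \<N>. x \<in> N \<and> N \<subseteq> V"
    if V: "nbhd_of (subtopology X S) x V" for V
  proof -
    obtain W where W: "nbhd_of X x W" "W \<inter> S \<subseteq> V"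
      using V by (rule nbhd_of_subtopologyE)
    then obtain N where "N \<in> \<N>" "x \<in> N" "N \<subseteq> W"
      using net Zero by (auto simp: network_at_def)
    then show ?thesis
      using W(2) x(2) by blast
  qed
  then show ?thesis
    by (simp add: Zero network_at_def)
qed

lemma kind_sigma_space_subtopology:
  assumes "kind_sigma_space k X"
  shows "kind_sigma_space k (subtopology X S)"
proof -
  obtain \<N> where \<N>: "sigma_locally_finite_in X \<N>" "kind_network_in k X \<N>"
    using assms by (auto simp: kind_sigma_space_def)
  then have "kind_network_in k (subtopology X S) ((\<lambda>N. N \<inter> S) ` \<N>)"
    by (fastforce simp: kind_network_in_def simp del: kind_network_at.simps
        intro: kind_network_at_subtopology)
  then show ?thesis
    using assms sigma_locally_finite_in_subtopology[OF \<N>(1)]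
    by (meson kind_sigma_space_def Hausdorff_space_subtopology regular_space_subtopology)
qed

section \<open>Open embeddings and topological sums\<close>

lemma nbhd_of_continuous_map_preimage:
  assumes "continuous_map X Y f" "x \<in> topspace X" "nbhd_of Y (f x) V"
  shows "nbhd_of X x {z \<in> topspace X. f z \<in> V}"
proof -
  obtain U where "openin Y U" "f x \<in> U" "U \<subseteq> V"
    using assms(3) unfolding nbhd_of_alt by blast
  then have "nbhd_of X x {z \<in> topspace X. f z \<in> U}"
    using assms by (intro openin_imp_nbhd_of openin_continuous_map_preimage[of X Y]) auto
  then show ?thesis
    by (rule nbhd_of_mono) (use \<open>U \<subseteq> V\<close> in auto)
qed

lemma nbhd_of_open_map_image:
  assumes "open_map X Y f" "nbhd_of X x U"
  shows "nbhd_of Y (f x) (f ` U)"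
proof -
  obtain T where T: "openin X T" "x \<in> T" "T \<subseteq> U" and "U \<subseteq> topspace X"
    using assms(2) unfolding nbhd_of_alt by blast
  have "openin Y (f ` T)"
    using assms(1) T(1) by (simp add: open_map_def)
  then have "nbhd_of Y (f x) (f ` T)"
    by (rule openin_imp_nbhd_of) (use T in auto)
  then show ?thesis
    by (rule nbhd_of_mono)
      (use T \<open>U \<subseteq> topspace X\<close> open_map_imp_subset_topspace[OF assms(1)] in auto)
qed

text \<open>Openness turns a neighbourhood \<open>T\<close> of \<open>x\<close> into a neighbourhood
  of \<open>f x\<close>; a point of \<open>A\<close> found there has a preimage in
  \<open>T\<close>.\<close>

lemma in_closure_of_open_map_preimage:
  assumes "open_map X Y f" "x \<in> topspace X" "f x \<in> Y closure_of A"
  shows "x \<in> X closure_of {z \<in> topspace X. f z \<in> A}"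
proof -
  have "\<exists>y. y \<in> {z \<in> topspace X. f z \<in> A} \<and> y \<in> T" if "x \<in> T" "openin X T" for T
  proof -
    have "openin Y (f ` T)" "f x \<in> f ` T"
      using assms(1) that by (auto simp: open_map_def)
    then obtain y where "y \<in> A" "y \<in> f ` T"
      using assms(3) unfolding in_closure_of by blast
    then show ?thesis
      using openin_subset[OF that(2)] by blast
  qed
  then show ?thesis
    using assms(2) by (simp add: in_closure_of)
qed

text \<open>The map makes \<open>X\<close> an open part of \<open>Y\<close>, and all six properties
  are local. \<open>\<M>\<close> is asked to contain the images rather than to consist of them
  because in a sum it also holds sets from other summands; none of the properties is lost when the
  family grows.\<close>

lemma kind_network_at_open_embedding:
  fixes X :: "'a topology" and Y :: "'b topology"
  assumes net: "kind_network_at k X \<N> x" and x: "x \<in> topspace X"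
    and cont: "continuous_map X Y f" and op: "open_map X Y f" and inj: "inj_on f (topspace X)"
    and sub: "\<N> \<subseteq> Pow (topspace X)" and im: "\<And>N. N \<in> \<N> \<Longrightarrow> f ` N \<in> \<M>"
  shows "kind_network_at k Y \<M> (f x)"
proof -
  define P where "P V = {z \<in> topspace X. f z \<in> V}" for V
  have P: "nbhd_of X x (P V)" if "nbhd_of Y (f x) V" for V
    using nbhd_of_continuous_map_preimage[OF cont x that] by (simp add: P_def)
  have image_P: "f ` N \<subseteq> V" if "N \<subseteq> P V" for N V
    using that by (auto simp: P_def)
  have "openin Y (f ` topspace X)"
    using op by (simp add: open_map_def)
  \<comment> \<open>The continuous inverse on the open image brings compact sets and sequences of
    \<open>Y\<close> back to \<open>X\<close>.\<close>
  obtain g where g: "continuous_map (subtopology Y (f ` topspace X)) X g"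
      "\<And>z. z \<in> topspace X \<Longrightarrow> g (f z) = z"
    using injective_open_imp_embedding_map[OF cont op inj]
    unfolding embedding_map_def homeomorphic_map_maps homeomorphic_maps_def by blast
  have pull: "\<exists>t. range t \<subseteq> topspace X \<and> limitin X t x sequentially \<and>
      (\<exists>m. \<forall>n\<ge>m. s n = f (t n))"
    if s: "limitin Y s (f x) sequentially" for s :: "nat \<Rightarrow> 'b"
  proof -
    obtain m where m: "s n \<in> f ` topspace X" if "n \<ge> m" for n
      using limitinD[OF s \<open>openin Y (f ` topspace X)\<close>] x
      by (auto simp: eventually_sequentially)
    \<comment> \<open>Terms outside the image are replaced by the limit \<open>x\<close>, so that
      all of \<open>t\<close> lies in \<open>topspace X\<close>, as the sequence properties demand;
      only indices below \<open>m\<close> can be affected.\<close>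
    define t where "t n = (if s n \<in> f ` topspace X then g (s n) else x)" for n
    have t: "t n \<in> topspace X" for n
      using x g(2) by (auto simp: t_def)
    have ft: "s n = f (t n)" if "n \<ge> m" for n
      using m[OF that] g(2) by (auto simp: t_def)
    have "limitin X t x sequentially"
      unfolding limitin_def
    proof (intro conjI allI impI x)
      fix U assume U: "openin X U \<and> x \<in> U"
      then have "openin Y (f ` U)" "f x \<in> f ` U"
        using op by (auto simp: open_map_def)
      then have "eventually (\<lambda>n. s n \<in> f ` U) sequentially"
        using s limitinD by fast
      moreover have "eventually (\<lambda>n. n \<ge> m) sequentially"
        by (rule eventually_ge_at_top)
      ultimately show "eventually (\<lambda>n. t n \<in> U) sequentially"
      proof eventually_elim
        case (elim n)
        then have "f (t n) \<in> f ` U"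
          using ft by simp
        then show ?case
          using inj_on_image_mem_iff[OF inj t] openin_subset[of X U] U by simp
      qed
    qed
    then show ?thesis
      using t ft by blast
  qed
  show ?thesis
  proof (cases k)
    case CK
    have "\<exists>U. nbhd_of Y (f x) U \<and> (\<forall>K. compactin Y K \<and> K \<subseteq> U \<longrightarrow>
        (\<exists>\<F>. finite \<F> \<and> \<F> \<subseteq> \<M> \<and> f x \<in> \<Inter>\<F> \<and> K \<subseteq> \<Union>\<F> \<and> \<Union>\<F> \<subseteq> V))"
      if V: "nbhd_of Y (f x) V" for V
    proof -
      obtain U where "nbhd_of X x U" and U: "\<And>K. compactin X K \<Longrightarrow> K \<subseteq> U \<Longrightarrow>
          \<exists>\<F>. finite \<F> \<and> \<F> \<subseteq> \<N> \<and> x \<in> \<Inter>\<F> \<and> K \<subseteq> \<Union>\<F> \<and> \<Union>\<F> \<subseteq> P V"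
        using net[unfolded CK kind_network_at.simps] P[OF V] by (rule ck_network_atE) blast
      have "U \<subseteq> topspace X"
        using \<open>nbhd_of X x U\<close> by (simp add: nbhd_of_alt)
      show ?thesis
      proof (intro exI[of _ "f ` U"] conjI allI impI)
        show "nbhd_of Y (f x) (f ` U)"
          using op \<open>nbhd_of X x U\<close> by (rule nbhd_of_open_map_image)
        fix K assume K: "compactin Y K \<and> K \<subseteq> f ` U"
        then have "compactin (subtopology Y (f ` topspace X)) K"
          using image_mono[OF \<open>U \<subseteq> topspace X\<close>, of f] by (simp add: compactin_subtopology) blast
        then have "compactin X (g ` K)"
          using g(1) by (rule image_compactin)
        moreover have "g ` K \<subseteq> U"
        proof -
          have "g ` K \<subseteq> g ` f ` U"
            using K by blast
          also have "\<dots> \<subseteq> U"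
            using g(2) \<open>U \<subseteq> topspace X\<close> by auto
          finally show ?thesis .
        qed
        ultimately obtain \<F> where \<F>: "finite \<F>" "\<F> \<subseteq> \<N>" "x \<in> \<Inter>\<F>" "g ` K \<subseteq> \<Union>\<F>" "\<Union>\<F> \<subseteq> P V"
          using U by meson
        \<comment> \<open>\<open>K\<close> lies in the image of \<open>U\<close>, so
          \<open>f\<close> undoes \<open>g\<close> on it, and the images of the sets covering the
          pulled-back compact set cover \<open>K\<close>.\<close>
        have "f (g y) = y" if "y \<in> K" for y
          using that K g(2) \<open>U \<subseteq> topspace X\<close> by (metis image_iff subsetD)
        then have "K = f ` g ` K"
          by (simp add: image_image)
        also have "\<dots> \<subseteq> \<Union>((`) f ` \<F>)"
          using \<F>(4) by blast
        finally have "K \<subseteq> \<Union>((`) f ` \<F>)" .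
        moreover have "finite ((`) f ` \<F>)" "(`) f ` \<F> \<subseteq> \<M>" "f x \<in> \<Inter>((`) f ` \<F>)"
          using \<F>(1-3) im by auto
        moreover have "\<Union>((`) f ` \<F>) \<subseteq> V"
          using image_P[OF \<F>(5)] by (simp add: image_Union)
        ultimately show "\<exists>\<F>. finite \<F> \<and> \<F> \<subseteq> \<M> \<and> f x \<in> \<Inter>\<F> \<and> K \<subseteq> \<Union>\<F> \<and> \<Union>\<F> \<subseteq> V"
          by blast
      qed
    qed
    then show ?thesis
      by (simp add: CK ck_network_at_def)
  next
    case CS
    have "\<exists>N\<in>\<M>. \<exists>k. {f x} \<union> {s n |n. n \<ge> k} \<subseteq> N \<and> N \<subseteq> V"
      if s: "limitin Y s (f x) sequentially" and V: "nbhd_of Y (f x) V"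
      for s :: "nat \<Rightarrow> 'b" and V
    proof -
      obtain t m where t: "range t \<subseteq> topspace X" "limitin X t x sequentially"
          and m: "\<And>n. n \<ge> m \<Longrightarrow> s n = f (t n)"
        using pull[OF s] by blast
      obtain N k where N: "N \<in> \<N>" "x \<in> N" "\<And>n. n \<ge> k \<Longrightarrow> t n \<in> N" "N \<subseteq> P V"
        using net[unfolded CS kind_network_at.simps] t P[OF V] by (rule cs_network_atE) blast
      \<comment> \<open>Beyond \<open>k\<close> the sequence \<open>t\<close> stays in
        \<open>N\<close>; beyond \<open>m\<close> it represents \<open>s\<close>.\<close>
      have "{f x} \<union> {s n |n. n \<ge> max k m} \<subseteq> f ` N"
        using N(2,3) m by auto
      then show ?thesis
        using im[OF N(1)] image_P[OF N(4)] by blast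
    qed
    then show ?thesis
      by (simp add: CS cs_network_at_def)
  next
    case CS_star
    have "\<exists>N\<in>\<M>. f x \<in> N \<and> N \<subseteq> V \<and> infinite {n. s n \<in> N}"
      if s: "limitin Y s (f x) sequentially" and V: "nbhd_of Y (f x) V"
      for s :: "nat \<Rightarrow> 'b" and V
    proof -
      obtain t m where t: "range t \<subseteq> topspace X" "limitin X t x sequentially"
          and m: "\<And>n. n \<ge> m \<Longrightarrow> s n = f (t n)"
        using pull[OF s] by blast
      obtain N where N: "N \<in> \<N>" "x \<in> N" "N \<subseteq> P V" "infinite {n. t n \<in> N}"
        using net[unfolded CS_star kind_network_at.simps] t P[OF V]
        by (rule cs_star_network_atE) blast
      \<comment> \<open>Passing from \<open>t\<close> to \<open>s\<close> can lose only the finitely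
        many indices below \<open>m\<close>.\<close>
      have "{n. t n \<in> N} \<subseteq> {n. s n \<in> f ` N} \<union> {..<m}"
        using m by (auto simp: not_less)
      then have "infinite {n. s n \<in> f ` N}"
        using N(4) finite_subset by fastforce
      then show ?thesis
        using im[OF N(1)] image_P[OF N(3)] N(2) by blast
    qed
    then show ?thesis
      by (simp add: CS_star cs_star_network_at_def)
  next
    case CP
    then have cp: "cp_network_at X \<N> x"
      using net by simp
    show ?thesis
    proof (cases "openin X {x}")
      case True
      then have "openin Y {f x}"
        using op by (force simp: open_map_def)
      moreover have "{f x} \<in> \<M>"
        using cp True im[of "{x}"] by (simp add: cp_network_at_def)
      ultimately show ?thesis
        by (simp add: CP cp_network_at_def)
    next
      case False
      \<comment> \<open>By injectivity \<open>f x\<close> can be isolated only if \<open>x\<close>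
        is, so the same alternative of the definition applies in both spaces.\<close>
      have "P {f x} = {x}"
        using x inj by (auto simp: P_def inj_on_def)
      then have "\<not> openin Y {f x}"
        using False openin_continuous_map_preimage[OF cont, of "{f x}"] by (auto simp: P_def)
      moreover have "\<exists>N\<in>\<M>. f x \<in> N \<and> N \<subseteq> V \<and> infinite (N \<inter> A)"
        if A: "f x \<in> Y closure_of A - A" and V: "nbhd_of Y (f x) V" for A V
      proof -
        have "x \<in> X closure_of P A - P A" "P A \<subseteq> topspace X"
          using in_closure_of_open_map_preimage[OF op x, of A] A by (auto simp: P_def)
        then obtain N where N: "N \<in> \<N>" "x \<in> N" "N \<subseteq> P V" "infinite (N \<inter> P A)"
          using cp_network_at_accumulation[OF cp _ _ P[OF V]] by blast
        \<comment> \<open>Injectivity keeps the captured part infinite when it is mapped into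
          \<open>A\<close>.\<close>
        have "inj_on f (N \<inter> P A)"
          by (rule inj_on_subset[OF inj]) (auto simp: P_def)
        then have "infinite (f ` (N \<inter> P A))"
          using N(4) by (simp add: finite_image_iff)
        moreover have "f ` (N \<inter> P A) \<subseteq> f ` N \<inter> A"
          by (auto simp: P_def)
        ultimately have "infinite (f ` N \<inter> A)"
          using finite_subset by blast
        then show ?thesis
          using im[OF N(1)] image_P[OF N(3)] N(2) by blast
      qed
      ultimately show ?thesis
        by (simp add: CP cp_network_at_def)
    qed
  next
    case CN
    have "nbhd_of Y (f x) (\<Union>{N \<in> \<M>. f x \<in> N \<and> N \<subseteq> V})" if V: "nbhd_of Y (f x) V" for V
    proof -
      have "nbhd_of X x (\<Union>{N \<in> \<N>. x \<in> N \<and> N \<subseteq> P V})"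
        using net CN P[OF V] by (simp add: cn_network_at_def)
      then have "nbhd_of Y (f x) (f ` \<Union>{N \<in> \<N>. x \<in> N \<and> N \<subseteq> P V})"
        by (rule nbhd_of_open_map_image[OF op])
      then show ?thesis
      proof (rule nbhd_of_mono)
        have "f ` N \<in> {N \<in> \<M>. f x \<in> N \<and> N \<subseteq> V}" if "N \<in> \<N>" "x \<in> N" "N \<subseteq> P V" for N
          using that im image_P by simp
        then show "f ` \<Union>{N \<in> \<N>. x \<in> N \<and> N \<subseteq> P V} \<subseteq> \<Union>{N \<in> \<M>. f x \<in> N \<and> N \<subseteq> V}"
          by blast
        show "\<Union>{N \<in> \<M>. f x \<in> N \<and> N \<subseteq> V} \<subseteq> topspace Y"
          using V by (auto simp: nbhd_of_alt)
      qed
    qed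
    then show ?thesis
      by (simp add: CN cn_network_at_def)
  next
    case Zero
    have "\<exists>N\<in>\<M>. f x \<in> N \<and> N \<subseteq> V" if V: "nbhd_of Y (f x) V" for V
    proof -
      obtain N where N: "N \<in> \<N>" "x \<in> N" "N \<subseteq> P V"
        using net Zero P[OF V] by (auto simp: network_at_def)
      then show ?thesis
        using im[OF N(1)] image_P[OF N(3)] by blast
    qed
    then show ?thesis
      by (simp add: Zero network_at_def)
  qed
qed

section \<open>Topological sums\<close>

lemma openin_sum_topology_Pair_image:
  assumes "i \<in> I" "openin (X i) U"
  shows "openin (sum_topology X I) (Pair i ` U)"
  using open_map_component_injection[OF assms(1), of X] assms(2) by (simp add: open_map_def)

lemma Hausdorff_space_sum_topology:
  assumes "\<And>i. i \<in> I \<Longrightarrow> Hausdorff_space (X i)"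
  shows "Hausdorff_space (sum_topology X I)"
  unfolding Hausdorff_space_def
proof (intro allI impI)
  fix p q assume pq: "p \<in> topspace (sum_topology X I) \<and> q \<in> topspace (sum_topology X I) \<and> p \<noteq> q"
  obtain i x j y where [simp]: "p = (i, x)" "q = (j, y)"
    by (metis surj_pair)
  have ij: "i \<in> I" "x \<in> topspace (X i)" "j \<in> I" "y \<in> topspace (X j)"
    using pq by auto
  show "\<exists>U V. openin (sum_topology X I) U \<and> openin (sum_topology X I) V \<and> p \<in> U \<and> q \<in> V \<and> disjnt U V"
  proof (cases "i = j")
    case True
    then have "x \<noteq> y"
      using pq by auto
    then obtain U V where UV: "openin (X i) U" "openin (X i) V" "x \<in> U" "y \<in> V" "disjnt U V"
      using assms[OF ij(1)] ij True unfolding Hausdorff_space_def by metis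
    then show ?thesis
      using True ij(1) by (intro exI[of _ "Pair i ` U"] exI[of _ "Pair i ` V"])
        (auto simp: disjnt_iff openin_sum_topology_Pair_image)
  next
    case False
    then show ?thesis
      using ij
      by (intro exI[of _ "Pair i ` topspace (X i)"] exI[of _ "Pair j ` topspace (X j)"])
        (auto simp: disjnt_iff openin_sum_topology_Pair_image)
  qed
qed

lemma regular_space_sum_topology:
  assumes "\<And>i. i \<in> I \<Longrightarrow> regular_space (X i)"
  shows "regular_space (sum_topology X I)"
  unfolding regular_space_def
proof (intro allI impI)
  fix C p assume C: "closedin (sum_topology X I) C \<and> p \<in> topspace (sum_topology X I) - C"
  obtain i x where p: "p = (i, x)"
    by (metis surj_pair)
  have ix: "i \<in> I" "x \<in> topspace (X i) - {z. (i, z) \<in> C}" "closedin (X i) {z. (i, z) \<in> C}"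
    using C p by (auto simp: closedin_sum_topology)
  then obtain U V where UV: "openin (X i) U" "openin (X i) V" "x \<in> U" "{z. (i, z) \<in> C} \<subseteq> V" "disjnt U V"
    using assms[OF ix(1)] unfolding regular_space_def by metis
  \<comment> \<open>\<open>C\<close> may reach into other summands, so \<open>V'\<close> contains
    those entirely; they are disjoint from any set inside summand \<open>i\<close>.\<close>
  define V' where "V' = (SIGMA j:I. if j = i then V else topspace (X j))"
  have "openin (sum_topology X I) (Pair i ` U)"
    using ix(1) UV(1) by (rule openin_sum_topology_Pair_image)
  moreover have "openin (sum_topology X I) V'"
    unfolding V'_def openin_disjoint_union using UV(2) by auto
  moreover have "C \<subseteq> V'"
  proof
    fix c assume "c \<in> C"
    obtain j z where c: "c = (j, z)"
      by (metis surj_pair)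
    have "j \<in> I" "z \<in> topspace (X j)"
      using C \<open>c \<in> C\<close> c closedin_subset by fastforce+
    then show "c \<in> V'"
      using UV(4) \<open>c \<in> C\<close> c by (auto simp: V'_def)
  qed
  moreover have "disjnt (Pair i ` U) V'"
    using UV(5) by (auto simp: V'_def disjnt_iff)
  ultimately show "\<exists>U V. openin (sum_topology X I) U \<and> openin (sum_topology X I) V \<and> p \<in> U \<and> C \<subseteq> V \<and> disjnt U V"
    using UV(3) p by blast
qed

text \<open>A neighbourhood inside one summand meets no sets from the others, so the size of
  \<open>I\<close> is unrestricted.\<close>

lemma locally_finite_in_sum_topology:
  assumes "\<And>i. i \<in> I \<Longrightarrow> locally_finite_in (X i) (\<A> i)"
  shows "locally_finite_in (sum_topology X I) (\<Union>i\<in>I. (`) (Pair i) ` \<A> i)"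
  unfolding locally_finite_in_def
proof (intro conjI ballI)
  show "\<Union>(\<Union>i\<in>I. (`) (Pair i) ` \<A> i) \<subseteq> topspace (sum_topology X I)"
    using assms by (fastforce simp: locally_finite_in_def)
  fix p assume "p \<in> topspace (sum_topology X I)"
  then obtain i x where p: "p = (i, x)" "i \<in> I" "x \<in> topspace (X i)"
    by auto
  then obtain V where V: "openin (X i) V" "x \<in> V" "finite {U \<in> \<A> i. U \<inter> V \<noteq> {}}"
    using assms[OF p(2)] p(3) unfolding locally_finite_in_def by blast
  have "{U \<in> \<Union>i\<in>I. (`) (Pair i) ` \<A> i. U \<inter> Pair i ` V \<noteq> {}}
      \<subseteq> (`) (Pair i) ` {U \<in> \<A> i. U \<inter> V \<noteq> {}}"
    by auto
  then have "finite {U \<in> \<Union>i\<in>I. (`) (Pair i) ` \<A> i. U \<inter> Pair i ` V \<noteq> {}}"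
    using V(3) by (rule finite_subset[OF _ finite_imageI])
  moreover have "openin (sum_topology X I) (Pair i ` V)"
    using p(2) V(1) by (rule openin_sum_topology_Pair_image)
  ultimately show "\<exists>V. openin (sum_topology X I) V \<and> p \<in> V \<and>
      finite {U \<in> \<Union>i\<in>I. (`) (Pair i) ` \<A> i. U \<inter> V \<noteq> {}}"
    using V(2) p(1) by blast
qed

lemma kind_sigma_space_sum_topology:
  assumes "\<And>i. i \<in> I \<Longrightarrow> kind_sigma_space k (X i)"
  shows "kind_sigma_space k (sum_topology X I)"
proof -
  have "\<forall>i\<in>I. \<exists>\<A> :: nat \<Rightarrow> 'b set set. (\<forall>n. locally_finite_in (X i) (\<A> n)) \<and>
      kind_network_in k (X i) (\<Union>n. \<A> n)"
    using assms unfolding kind_sigma_space_def sigma_locally_finite_in_def by blast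
  then obtain \<A> :: "'a \<Rightarrow> nat \<Rightarrow> 'b set set"
    where \<A>: "\<And>i n. i \<in> I \<Longrightarrow> locally_finite_in (X i) (\<A> i n)"
      "\<And>i. i \<in> I \<Longrightarrow> kind_network_in k (X i) (\<Union>n. \<A> i n)"
    by metis
  \<comment> \<open>The union over \<open>I\<close> is taken within each level \<open>n\<close>: a
    level stays locally finite for arbitrary \<open>I\<close>, and only the levels have to be
    countable in number.\<close>
  define \<M> where "\<M> = (\<Union>n. \<Union>i\<in>I. (`) (Pair i) ` \<A> i n)"
  have "sigma_locally_finite_in (sum_topology X I) \<M>"
    unfolding \<M>_def by (intro sigma_locally_finite_in_UN locally_finite_in_sum_topology \<A>) auto
  moreover have "kind_network_in k (sum_topology X I) \<M>"
    unfolding kind_network_in_def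
  proof (intro conjI ballI)
    show "\<M> \<subseteq> Pow (topspace (sum_topology X I))"
      using \<A>(1) by (fastforce simp: \<M>_def locally_finite_in_def)
    fix p assume "p \<in> topspace (sum_topology X I)"
    then obtain i x where p: "p = (i, x)" "i \<in> I" "x \<in> topspace (X i)"
      by auto
    have "kind_network_at k (sum_topology X I) \<M> (Pair i x)"
    proof (rule kind_network_at_open_embedding[where X = "X i" and \<N> = "\<Union>n. \<A> i n"])
      show "kind_network_at k (X i) (\<Union>n. \<A> i n) x" "(\<Union>n. \<A> i n) \<subseteq> Pow (topspace (X i))"
        using \<A>(2)[OF p(2)] p(3) unfolding kind_network_in_def by blast+
      show "continuous_map (X i) (sum_topology X I) (Pair i)"
        using continuous_map_component_injection[OF p(2)] .
      show "open_map (X i) (sum_topology X I) (Pair i)"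
        using open_map_component_injection[OF p(2)] .
    qed (use p in \<open>auto simp: \<M>_def inj_on_def\<close>)
    then show "kind_network_at k (sum_topology X I) \<M> p"
      by (simp add: p(1))
  qed
  moreover have "Hausdorff_space (sum_topology X I)" "regular_space (sum_topology X I)"
    using assms unfolding kind_sigma_space_def
    by (blast intro: Hausdorff_space_sum_topology regular_space_sum_topology)+
  ultimately show ?thesis
    unfolding kind_sigma_space_def by blast
qed

section \<open>Products\<close>

definition cylinder :: "('j \<Rightarrow> 'c topology) \<Rightarrow> 'j set \<Rightarrow> 'j set \<Rightarrow> ('j \<Rightarrow> 'c set) \<Rightarrow> ('j \<Rightarrow> 'c) set" where
  "cylinder X J F N = {f \<in> topspace (product_topology X J). \<forall>j\<in>F. f j \<in> N j}"

text \<open>Coordinates outside \<open>F\<close> stay free because a factor's network need not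
  contain the whole factor. Finite sets \<open>F\<close> suffice for small neighbourhoods, and a
  countable \<open>J\<close> has only countably many of them.\<close>

definition cylinders :: "('j \<Rightarrow> 'c topology) \<Rightarrow> 'j set \<Rightarrow> ('j \<Rightarrow> 'c set set) \<Rightarrow> ('j \<Rightarrow> 'c) set set" where
  "cylinders X J \<N> = {cylinder X J F N |F N. finite F \<and> F \<subseteq> J \<and> (\<forall>j\<in>F. N j \<in> \<N> j)}"

lemma cylinder_subset_topspace: "cylinder X J F N \<subseteq> topspace (product_topology X J)"
  by (auto simp: cylinder_def)

lemma cylinder_mono: "(\<And>j. j \<in> F \<Longrightarrow> M j \<subseteq> N j) \<Longrightarrow> cylinder X J F M \<subseteq> cylinder X J F N"
  by (auto simp: cylinder_def)

lemma cylinder_in_cylinders: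
  "finite F \<Longrightarrow> F \<subseteq> J \<Longrightarrow> (\<And>j. j \<in> F \<Longrightarrow> N j \<in> \<N> j) \<Longrightarrow> cylinder X J F N \<in> cylinders X J \<N>"
  by (auto simp: cylinders_def)

lemma openin_cylinder:
  assumes "finite F" "F \<subseteq> J" "\<And>j. j \<in> F \<Longrightarrow> openin (X j) (W j)"
  shows "openin (product_topology X J) (cylinder X J F W)"
  using assms
proof (induction F rule: finite_induct)
  case empty
  then show ?case
    by (simp add: cylinder_def del: topspace_product_topology)
next
  case (insert i F)
  have "cylinder X J (insert i F) W =
      {f \<in> topspace (product_topology X J). f i \<in> W i} \<inter> cylinder X J F W"
    by (auto simp: cylinder_def)
  moreover have "openin (product_topology X J) {f \<in> topspace (product_topology X J). f i \<in> W i}"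
    by (rule openin_continuous_map_preimage[OF continuous_map_product_projection])
      (use insert.prems in auto)
  ultimately show ?case
    using insert by auto
qed

lemma nbhd_of_product_topologyE:
  assumes "nbhd_of (product_topology X J) x V"
  obtains F W where "finite F" "F \<subseteq> J" "\<And>j. j \<in> F \<Longrightarrow> openin (X j) (W j)"
    "\<And>j. j \<in> F \<Longrightarrow> x j \<in> W j" "cylinder X J F W \<subseteq> V"
proof -
  obtain T where T: "openin (product_topology X J) T" "x \<in> T" "T \<subseteq> V"
    using assms unfolding nbhd_of_alt by blast
  obtain W where W: "finite {i \<in> J. W i \<noteq> topspace (X i)}" "\<forall>i\<in>J. openin (X i) (W i)"
      "x \<in> Pi\<^sub>E J W" "Pi\<^sub>E J W \<subseteq> T"
    using bspec[OF iffD1[OF openin_product_topology_alt T(1)] T(2)] by (elim exE conjE)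
  \<comment> \<open>Outside this finite set the basic box has whole factors as sides, so those
    coordinates impose no condition.\<close>
  define F where "F = {i \<in> J. W i \<noteq> topspace (X i)}"
  have "cylinder X J F W \<subseteq> Pi\<^sub>E J W"
  proof
    fix f assume f: "f \<in> cylinder X J F W"
    then have "f j \<in> W j" if "j \<in> J" for j
      using that by (cases "j \<in> F") (auto simp: cylinder_def F_def)
    then show "f \<in> Pi\<^sub>E J W"
      using f by (auto simp: cylinder_def PiE_iff)
  qed
  show ?thesis
  proof (rule that)
    show "finite F" "F \<subseteq> J" "\<And>j. j \<in> F \<Longrightarrow> openin (X j) (W j)" "\<And>j. j \<in> F \<Longrightarrow> x j \<in> W j"
      using W(1-3) by (auto simp: F_def)
    show "cylinder X J F W \<subseteq> V"
      using \<open>cylinder X J F W \<subseteq> Pi\<^sub>E J W\<close> W(4) T(3) by simp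
  qed
qed

lemma nbhd_of_cylinder:
  assumes "x \<in> topspace (product_topology X J)" "finite F" "F \<subseteq> J"
    "\<And>j. j \<in> F \<Longrightarrow> nbhd_of (X j) (x j) (W j)"
  shows "nbhd_of (product_topology X J) x (cylinder X J F W)"
proof -
  have "\<forall>j\<in>F. \<exists>T. openin (X j) T \<and> x j \<in> T \<and> T \<subseteq> W j"
    using assms(4) unfolding nbhd_of_alt by blast
  then obtain T where T: "\<And>j. j \<in> F \<Longrightarrow> openin (X j) (T j)" "\<And>j. j \<in> F \<Longrightarrow> x j \<in> T j"
      "\<And>j. j \<in> F \<Longrightarrow> T j \<subseteq> W j"
    by metis
  have "nbhd_of (product_topology X J) x (cylinder X J F T)"
    using assms(1) T(2) by (intro openin_imp_nbhd_of openin_cylinder assms T(1)) (auto simp: cylinder_def)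
  then show ?thesis
    by (rule nbhd_of_mono[OF _ cylinder_mono[OF T(3)] cylinder_subset_topspace])
qed

text \<open>Around \<open>x\<close>, take the cylinder over neighbourhoods that witness local
  finiteness in each factor. Any member meeting it has each side \<open>N j\<close> meeting
  \<open>V j\<close>, which leaves finitely many choices at finitely many coordinates. Extensional
  choices in \<open>Pi\<^sub>E\<close> make this count literal.\<close>

lemma locally_finite_in_cylinder_image:
  assumes "finite F" "F \<subseteq> J" "\<And>j. j \<in> F \<Longrightarrow> locally_finite_in (X j) (\<A> j)"
  shows "locally_finite_in (product_topology X J) (cylinder X J F ` Pi\<^sub>E F \<A>)"
  unfolding locally_finite_in_def
proof (intro conjI ballI)
  show "\<Union>(cylinder X J F ` Pi\<^sub>E F \<A>) \<subseteq> topspace (product_topology X J)"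
    using cylinder_subset_topspace by fast
  fix x assume x: "x \<in> topspace (product_topology X J)"
  have "\<forall>j\<in>F. \<exists>V. openin (X j) V \<and> x j \<in> V \<and> finite {U \<in> \<A> j. U \<inter> V \<noteq> {}}"
  proof
    fix j assume "j \<in> F"
    moreover from this have "x j \<in> topspace (X j)"
      using x assms(2) by auto
    ultimately show "\<exists>V. openin (X j) V \<and> x j \<in> V \<and> finite {U \<in> \<A> j. U \<inter> V \<noteq> {}}"
      using assms(3) unfolding locally_finite_in_def by blast
  qed
  from bchoice[OF this] obtain V where "\<forall>j\<in>F. openin (X j) (V j) \<and> x j \<in> V j \<and>
      finite {U \<in> \<A> j. U \<inter> V j \<noteq> {}}" ..
  then have V: "\<And>j. j \<in> F \<Longrightarrow> openin (X j) (V j)" "\<And>j. j \<in> F \<Longrightarrow> x j \<in> V j"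
      "\<And>j. j \<in> F \<Longrightarrow> finite {U \<in> \<A> j. U \<inter> V j \<noteq> {}}"
    by simp_all
  have "{U \<in> cylinder X J F ` Pi\<^sub>E F \<A>. U \<inter> cylinder X J F V \<noteq> {}}
      \<subseteq> cylinder X J F ` (\<Pi>\<^sub>E j\<in>F. {U \<in> \<A> j. U \<inter> V j \<noteq> {}})"
  proof
    fix C assume "C \<in> {U \<in> cylinder X J F ` Pi\<^sub>E F \<A>. U \<inter> cylinder X J F V \<noteq> {}}"
    then obtain N f where N: "C = cylinder X J F N" "N \<in> Pi\<^sub>E F \<A>"
        and f: "f \<in> cylinder X J F N" "f \<in> cylinder X J F V"
      by blast
    have "N j \<inter> V j \<noteq> {}" if "j \<in> F" for j
      using f that unfolding cylinder_def by blast
    then have "N \<in> (\<Pi>\<^sub>E j\<in>F. {U \<in> \<A> j. U \<inter> V j \<noteq> {}})"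
      using N(2) by (simp add: PiE_iff)
    then show "C \<in> cylinder X J F ` (\<Pi>\<^sub>E j\<in>F. {U \<in> \<A> j. U \<inter> V j \<noteq> {}})"
      using N(1) by blast
  qed
  moreover have "finite (\<Pi>\<^sub>E j\<in>F. {U \<in> \<A> j. U \<inter> V j \<noteq> {}})"
    using assms(1) V(3) by (rule finite_PiE)
  ultimately have "finite {U \<in> cylinder X J F ` Pi\<^sub>E F \<A>. U \<inter> cylinder X J F V \<noteq> {}}"
    by (rule finite_subset[OF _ finite_imageI])
  moreover have "openin (product_topology X J) (cylinder X J F V)"
    using assms(1,2) V(1) by (rule openin_cylinder)
  moreover have "x \<in> cylinder X J F V"
    using x V(2) by (simp add: cylinder_def)
  ultimately show "\<exists>V. openin (product_topology X J) V \<and> x \<in> V \<and>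
      finite {U \<in> cylinder X J F ` Pi\<^sub>E F \<A>. U \<inter> V \<noteq> {}}"
    by (intro exI[of _ "cylinder X J F V"] conjI)
qed

lemma cylinder_cong: "(\<And>j. j \<in> F \<Longrightarrow> M j = N j) \<Longrightarrow> cylinder X J F M = cylinder X J F N"
  by (auto simp: cylinder_def)

text \<open>Fixing the finite set \<open>F\<close> and a level \<open>\<nu> j\<close> for each of
  its coordinates isolates one locally finite piece; countability of \<open>J\<close> leaves
  countably many such pairs.\<close>

lemma sigma_locally_finite_in_cylinders:
  fixes \<A> :: "'j \<Rightarrow> nat \<Rightarrow> 'c set set"
  assumes "countable J" "\<And>j n. j \<in> J \<Longrightarrow> locally_finite_in (X j) (\<A> j n)"
  shows "sigma_locally_finite_in (product_topology X J) (cylinders X J (\<lambda>j. \<Union>n. \<A> j n))"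
proof -
  define I where "I = (SIGMA F:{F. finite F \<and> F \<subseteq> J}. Pi\<^sub>E F (\<lambda>_. UNIV :: nat set))"
  define \<B> where "\<B> p = (case p of (F, \<nu>) \<Rightarrow> cylinder X J F ` (\<Pi>\<^sub>E j\<in>F. \<A> j (\<nu> j)))" for p
  have "countable I"
    unfolding I_def using assms(1)
    by (intro countable_SIGMA countable_Collect_finite_subset countable_PiE) auto
  then have "sigma_locally_finite_in (product_topology X J) (\<Union>p\<in>I. \<B> p)"
  proof (rule sigma_locally_finite_in_UN)
    fix p assume "p \<in> I"
    then show "locally_finite_in (product_topology X J) (\<B> p)"
      using assms(2) by (auto simp: I_def \<B>_def intro!: locally_finite_in_cylinder_image)
  qed
  moreover have "cylinders X J (\<lambda>j. \<Union>n. \<A> j n) = (\<Union>p\<in>I. \<B> p)"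
  proof (intro equalityI subsetI)
    fix C assume "C \<in> cylinders X J (\<lambda>j. \<Union>n. \<A> j n)"
    then obtain F N where C: "C = cylinder X J F N" and F: "finite F" "F \<subseteq> J"
        and N: "\<forall>j\<in>F. N j \<in> (\<Union>n. \<A> j n)"
      by (auto simp: cylinders_def)
    then have "\<forall>j\<in>F. \<exists>n. N j \<in> \<A> j n"
      by simp
    then obtain \<nu> where \<nu>: "\<And>j. j \<in> F \<Longrightarrow> N j \<in> \<A> j (\<nu> j)"
      by metis
    \<comment> \<open>Restriction makes the choice extensional, as membership in
      \<open>Pi\<^sub>E\<close> requires, without changing the cylinder.\<close>
    have "C = cylinder X J F (restrict N F)"
      unfolding C by (rule cylinder_cong) simp
    then have "C \<in> \<B> (F, restrict \<nu> F)"
      using \<nu> by (auto simp: \<B>_def)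
    moreover have "(F, restrict \<nu> F) \<in> I"
      using F by (auto simp: I_def)
    ultimately show "C \<in> (\<Union>p\<in>I. \<B> p)"
      by blast
  next
    fix C assume "C \<in> (\<Union>p\<in>I. \<B> p)"
    then obtain F \<nu> N where "C = cylinder X J F N" "finite F" "F \<subseteq> J" "N \<in> (\<Pi>\<^sub>E j\<in>F. \<A> j (\<nu> j))"
      by (auto simp: I_def \<B>_def)
    then show "C \<in> cylinders X J (\<lambda>j. \<Union>n. \<A> j n)"
      by (auto simp: PiE_iff intro!: cylinder_in_cylinders)
  qed
  ultimately show ?thesis
    by simp
qed

section \<open>Network properties at a point of a product\<close>

text \<open>Members chosen independently could capture disjoint sets of indices. Each new coordinate
  is therefore treated along the subsequence already found, which still converges, and thinning it
  further keeps the earlier coordinates in their sets.\<close>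

lemma cs_star_network_at_simultaneous_subsequence:
  fixes s :: "nat \<Rightarrow> 'j \<Rightarrow> 'c"
  assumes "finite F"
    and "\<And>j. j \<in> F \<Longrightarrow> cs_star_network_at (X j) (\<N> j) (x j)"
    and "\<And>j. j \<in> F \<Longrightarrow> range (\<lambda>n. s n j) \<subseteq> topspace (X j)"
    and "\<And>j. j \<in> F \<Longrightarrow> limitin (X j) (\<lambda>n. s n j) (x j) sequentially"
    and "\<And>j. j \<in> F \<Longrightarrow> nbhd_of (X j) (x j) (W j)"
  shows "\<exists>N r. strict_mono (r :: nat \<Rightarrow> nat) \<and>
    (\<forall>j\<in>F. N j \<in> \<N> j \<and> x j \<in> N j \<and> N j \<subseteq> W j \<and> (\<forall>n. s (r n) j \<in> N j))"
  using assms
proof (induction F rule: finite_induct)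
  case empty
  then show ?case
    by (intro exI[of _ "\<lambda>_. {}"] exI[of _ id]) (simp add: strict_mono_def)
next
  case (insert i F)
  have "\<exists>N r. strict_mono (r :: nat \<Rightarrow> nat) \<and>
      (\<forall>j\<in>F. N j \<in> \<N> j \<and> x j \<in> N j \<and> N j \<subseteq> W j \<and> (\<forall>n. s (r n) j \<in> N j))"
    by (rule insert.IH) (rule insert.prems, simp)+
  then obtain N and r :: "nat \<Rightarrow> nat" where r: "strict_mono r"
      and N: "\<forall>j\<in>F. N j \<in> \<N> j \<and> x j \<in> N j \<and> N j \<subseteq> W j \<and> (\<forall>n. s (r n) j \<in> N j)"
    by (elim exE conjE)
  have "range (\<lambda>n. s (r n) i) \<subseteq> topspace (X i)"
    using insert.prems(2)[of i] by auto
  moreover have "limitin (X i) (\<lambda>n. s (r n) i) (x i) sequentially"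
    using limitin_subsequence[OF r insert.prems(3)[of i]] by (simp add: o_def)
  ultimately obtain M where M: "M \<in> \<N> i" "x i \<in> M" "M \<subseteq> W i" "infinite {n. s (r n) i \<in> M}"
    by (rule cs_star_network_atE[OF insert.prems(1)[OF insertI1] _ _ insert.prems(4)[OF insertI1]])
  \<comment> \<open>\<open>q\<close> lists the positions along \<open>r\<close> captured by
    \<open>M\<close>, so \<open>r \<circ> q\<close> is the thinned subsequence.\<close>
  define q where "q = enumerate {n. s (r n) i \<in> M}"
  have "strict_mono q" "\<And>n. s (r (q n)) i \<in> M"
    using strict_mono_enumerate[OF M(4)] enumerate_in_set[OF M(4)] by (auto simp: q_def)
  then show ?case
    using M(1-3) N r insert.hyps(2)
    by (intro exI[of _ "N(i := M)"] exI[of _ "r \<circ> q"]) (auto simp: strict_mono_def)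
qed

text \<open>
  In the proof the rank \<open>h j b\<close> is the index of the first member, in an enumeration of
  the countably many candidates at \<open>x j\<close>, that contains \<open>b\<close>.  If the claim
  fails, only finitely many points of \<open>A\<close> have all ranks below a given bound.
\<close>

lemma cp_network_at_cylinder_accumulation:
  assumes x: "x \<in> topspace (product_topology X J)" and t1: "t1_space (product_topology X J)"
    and cp: "\<And>j. j \<in> J \<Longrightarrow> cp_network_at (X j) (\<N> j) (x j)"
    and count: "\<And>j. j \<in> J \<Longrightarrow> countable {N \<in> \<N> j. x j \<in> N}"
    and A: "A \<subseteq> topspace (product_topology X J)" "x \<in> product_topology X J closure_of A - A"
    and F: "finite F" "F \<subseteq> J" and W: "\<And>j. j \<in> F \<Longrightarrow> nbhd_of (X j) (x j) (W j)"
  shows "\<exists>N. (\<forall>j\<in>F. N j \<in> \<N> j \<and> x j \<in> N j \<and> N j \<subseteq> W j) \<and> infinite (cylinder X J F N \<inter> A)"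
proof (rule ccontr)
  assume no: "\<not> ?thesis"
  define C where "C j = {N \<in> \<N> j. x j \<in> N \<and> N \<subseteq> W j}" for j
  have contra: "finite (cylinder X J F N \<inter> A)" if "\<And>j. j \<in> F \<Longrightarrow> N j \<in> C j" for N
  proof (rule ccontr)
    assume "infinite (cylinder X J F N \<inter> A)"
    moreover have "\<forall>j\<in>F. N j \<in> \<N> j \<and> x j \<in> N j \<and> N j \<subseteq> W j"
      using that by (simp add: C_def)
    ultimately have "\<exists>N. (\<forall>j\<in>F. N j \<in> \<N> j \<and> x j \<in> N j \<and> N j \<subseteq> W j) \<and> infinite (cylinder X J F N \<inter> A)"
      by (intro exI[of _ N] conjI)
    with no show False
      by (rule notE)
  qed
  have xj: "x j \<in> topspace (X j)" if "j \<in> F" for j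
    using x F(2) that by auto
  have C_countable: "countable (C j)" if "j \<in> F" for j
    by (rule countable_subset[OF _ count[of j]]) (use that F(2) in \<open>auto simp: C_def\<close>)
  have C_nonempty: "C j \<noteq> {}" if "j \<in> F" for j
  proof -
    have "network_at (X j) (\<N> j) (x j)"
      using that F(2) by (intro cp_network_at_imp_network_at cp xj) auto
    then show ?thesis
      using W[OF that] unfolding network_at_def C_def by blast
  qed
  \<comment> \<open>If \<open>C j\<close> is finite the enumeration repeats members, which does no
    harm to a least index.\<close>
  define E where "E j = from_nat_into (C j)" for j
  have E: "E j k \<in> C j" if "j \<in> F" for j k
    unfolding E_def using C_nonempty[OF that] by (rule from_nat_into)
  have E_surj: "\<exists>k. N = E j k" if "j \<in> F" "N \<in> C j" for j N
    unfolding E_def using from_nat_into_surj[OF C_countable[OF that(1)] that(2)] by (elim exE) auto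
  define h where "h j b = (LEAST k. b \<in> E j k)" for j b
  have h_le: "h j b \<le> k" if "b \<in> E j k" for j b k
    unfolding h_def using that by (rule Least_le)
  \<comment> \<open>Every candidate contains \<open>x j\<close>, already the one with index 0. Hence
    a positive rank at \<open>j\<close> means a coordinate different from
    \<open>x j\<close>.\<close>
  have h_x: "h j (x j) = 0" if "j \<in> F" for j
    using h_le[of "x j" j 0] E[OF that, of 0] by (simp add: C_def)
  \<comment> \<open>The \<open>LEAST\<close> defining a rank is meaningful only for coordinates
    covered by some candidate.\<close>
  define A' where "A' = A \<inter> cylinder X J F (\<lambda>j. \<Union>(C j))"
  have in_E_h: "a j \<in> E j (h j (a j))" if a: "a \<in> A'" and j: "j \<in> F" for a j
  proof -
    have "a j \<in> \<Union>(C j)"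
      using a j by (simp add: A'_def cylinder_def)
    then have "\<exists>k. a j \<in> E j k"
      using E_surj[OF j] by blast
    then show ?thesis
      unfolding h_def by (rule LeastI_ex)
  qed
  \<comment> \<open>Ranks at most \<open>i\<close> place a point in one of finitely many cylinders
    with sides among the first \<open>i + 1\<close> enumerated candidates, and by
    \<open>contra\<close> each of these meets \<open>A\<close> in a finite set.\<close>
  have finite_rank: "finite {a \<in> A'. \<forall>j\<in>F. h j (a j) \<le> i}" for i
  proof (rule finite_subset)
    show "{a \<in> A'. \<forall>j\<in>F. h j (a j) \<le> i}
        \<subseteq> (\<Union>\<kappa>\<in>Pi\<^sub>E F (\<lambda>_. {..i}). cylinder X J F (\<lambda>j. E j (\<kappa> j)) \<inter> A)"
    proof
      fix a assume a: "a \<in> {a \<in> A'. \<forall>j\<in>F. h j (a j) \<le> i}"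
      then have "a \<in> cylinder X J F (\<lambda>j. E j (restrict (\<lambda>j. h j (a j)) F j)) \<inter> A"
        using in_E_h by (auto simp: A'_def cylinder_def)
      moreover have "restrict (\<lambda>j. h j (a j)) F \<in> Pi\<^sub>E F (\<lambda>_. {..i})"
        using a by auto
      ultimately show "a \<in> (\<Union>\<kappa>\<in>Pi\<^sub>E F (\<lambda>_. {..i}). cylinder X J F (\<lambda>j. E j (\<kappa> j)) \<inter> A)"
        by blast
    qed
    show "finite (\<Union>\<kappa>\<in>Pi\<^sub>E F (\<lambda>_. {..i}). cylinder X J F (\<lambda>j. E j (\<kappa> j)) \<inter> A)"
      using F(1) contra E by (intro finite_UN_I finite_PiE) auto
  qed
  \<comment> \<open>Positivity keeps \<open>x j\<close> out of the projection of \<open>B j\<close>;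
    maximality turns a bound on the rank at \<open>j\<close> into a bound at all coordinates in
    \<open>F\<close>.\<close>
  define B where "B j = {a \<in> A'. h j (a j) > 0 \<and> (\<forall>l\<in>F. h l (a l) \<le> h j (a j))}" for j
  have "x \<in> product_topology X J closure_of A'"
  proof -
    \<comment> \<open>By the \<open>cn\<close> property the points covered by candidates form a
      neighbourhood, so discarding the remaining points of \<open>A\<close> does not affect
      accumulation at \<open>x\<close>.\<close>
    have "nbhd_of (X j) (x j) (\<Union>(C j))" if "j \<in> F" for j
    proof -
      have "cn_network_at (X j) (\<N> j) (x j)"
        using that F(2) by (intro cp_network_at_imp_cn_network_at cp xj) auto
      then show ?thesis
        using W[OF that] unfolding cn_network_at_def C_def by simp
    qed
    then have "nbhd_of (product_topology X J) x (cylinder X J F (\<lambda>j. \<Union>(C j)))"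
      by (rule nbhd_of_cylinder[OF x F])
    then obtain T where T: "openin (product_topology X J) T" "x \<in> T"
        "T \<subseteq> cylinder X J F (\<lambda>j. \<Union>(C j))"
      unfolding nbhd_of_alt by blast
    have "x \<in> product_topology X J closure_of (T \<inter> A)"
      using A(2) T(1,2) openin_Int_closure_of_subset by fast
    moreover have "T \<inter> A \<subseteq> A'"
      using T(3) by (auto simp: A'_def)
    ultimately show ?thesis
      using closure_of_mono by blast
  qed
  moreover have "x \<notin> A'"
    using A(2) by (simp add: A'_def)
  \<comment> \<open>Points with all ranks 0 belong to no \<open>B j\<close>; there are finitely many
    of them, so T1 permits their removal.\<close>
  ultimately have "x \<in> product_topology X J closure_of (A' - {a \<in> A'. \<forall>j\<in>F. h j (a j) \<le> 0})"
    by (intro closure_of_diff_finite t1 finite_rank) simp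
  moreover have "A' - {a \<in> A'. \<forall>j\<in>F. h j (a j) \<le> 0} \<subseteq> \<Union>(B ` F)"
  proof
    fix a assume a: "a \<in> A' - {a \<in> A'. \<forall>j\<in>F. h j (a j) \<le> 0}"
    then obtain i where i: "i \<in> F" "h i (a i) > 0"
      by (auto simp: not_le)
    then have "Max ((\<lambda>l. h l (a l)) ` F) \<in> (\<lambda>l. h l (a l)) ` F"
      using F(1) by (intro Max_in) auto
    then obtain j where "j \<in> F" "h j (a j) = Max ((\<lambda>l. h l (a l)) ` F)"
      by auto
    moreover from this have "h l (a l) \<le> h j (a j)" if "l \<in> F" for l
      using that F(1) by simp
    ultimately show "a \<in> \<Union>(B ` F)"
      using a i by (fastforce simp: B_def)
  qed
  ultimately have "x \<in> product_topology X J closure_of \<Union>(B ` F)"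
    using closure_of_mono by blast
  then obtain j where j: "j \<in> F" "x \<in> product_topology X J closure_of B j"
    using F(1) by (auto simp: closure_of_Union)
  define \<pi> where "\<pi> a = a j" for a :: "'a \<Rightarrow> 'b"
  have "continuous_map (product_topology X J) (X j) \<pi>"
    unfolding \<pi>_def using j(1) F(2) by (intro continuous_map_product_projection) auto
  then have "x j \<in> X j closure_of \<pi> ` B j"
    using continuous_map_image_closure_subset j(2) unfolding \<pi>_def by fast
  moreover have "x j \<notin> \<pi> ` B j"
    using h_x[OF j(1)] by (auto simp: B_def \<pi>_def)
  moreover have "\<pi> ` B j \<subseteq> topspace (X j)"
    using A(1) j(1) F(2) by (force simp: B_def A'_def \<pi>_def)
  ultimately obtain N where N: "N \<in> \<N> j" "x j \<in> N" "N \<subseteq> W j" "infinite (N \<inter> \<pi> ` B j)"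
    using cp_network_at_accumulation[OF cp _ _ W[OF j(1)], of "\<pi> ` B j"] j(1) F(2) by blast
  then obtain k where k: "N = E j k"
    using E_surj[OF j(1), of N] by (auto simp: C_def)
  \<comment> \<open>A point of \<open>B j\<close> whose coordinate lies in \<open>E j k\<close> has
    rank at most \<open>k\<close> at \<open>j\<close>, hence at all of \<open>F\<close>. Only
    finitely many points satisfy this, yet \<open>N\<close> should meet the projection in an
    infinite set.\<close>
  have "N \<inter> \<pi> ` B j \<subseteq> \<pi> ` {a \<in> A'. \<forall>l\<in>F. h l (a l) \<le> k}"
    using h_le[of _ j k] by (fastforce simp: B_def \<pi>_def k)
  then show False
    using N(4) finite_rank finite_subset by blast
qed

lemma cp_network_at_product_topology:
  assumes x: "x \<in> topspace (product_topology X J)" and t1: "t1_space (product_topology X J)"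
    and cp: "\<And>j. j \<in> J \<Longrightarrow> cp_network_at (X j) (\<N> j) (x j)"
    and count: "\<And>j. j \<in> J \<Longrightarrow> countable {N \<in> \<N> j. x j \<in> N}"
  shows "cp_network_at (product_topology X J) (cylinders X J \<N>) x"
proof (cases "openin (product_topology X J) {x}")
  case True
  then have "nbhd_of (product_topology X J) x {x}"
    by (simp add: openin_imp_nbhd_of)
  then obtain F W where F: "finite F" "F \<subseteq> J" and W: "\<And>j. j \<in> F \<Longrightarrow> openin (X j) (W j)"
      "\<And>j. j \<in> F \<Longrightarrow> x j \<in> W j" "cylinder X J F W \<subseteq> {x}"
    by (rule nbhd_of_product_topologyE) blast
  \<comment> \<open>Replacing coordinate \<open>j\<close> of \<open>x\<close> by any point of
    \<open>W j\<close> stays in a cylinder contained in \<open>{x}\<close>. So the constrained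
    coordinates are isolated in their factors, whose networks then contain these singletons.\<close>
  have W_eq: "W j = {x j}" if j: "j \<in> F" for j
  proof -
    have "y = x j" if y: "y \<in> W j" for y
    proof -
      have "y \<in> topspace (X j)"
        using y openin_subset[OF W(1)[OF j]] by blast
      then have "x(j := y) \<in> cylinder X J F W"
        using x W(2) y j F(2) by (auto simp: cylinder_def PiE_iff extensional_def)
      then have "x(j := y) = x"
        using W(3) by blast
      then show ?thesis
        by (metis fun_upd_same)
    qed
    then show ?thesis
      using W(2)[OF j] by blast
  qed
  then have "W j \<in> \<N> j" if "j \<in> F" for j
    using cp[of j] W(1)[OF that] F(2) that by (auto simp: cp_network_at_def)
  then have "cylinder X J F W \<in> cylinders X J \<N>"
    by (intro cylinder_in_cylinders F)
  moreover have "cylinder X J F W = {x}"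
    using W(2,3) x by (auto simp: cylinder_def)
  ultimately show ?thesis
    using True by (simp add: cp_network_at_def)
next
  case False
  have "\<exists>N\<in>cylinders X J \<N>. x \<in> N \<and> N \<subseteq> V \<and> infinite (N \<inter> A)"
    if A: "A \<subseteq> topspace (product_topology X J)" "x \<in> product_topology X J closure_of A - A"
      and V: "nbhd_of (product_topology X J) x V" for A V
  proof -
    obtain F W where F: "finite F" "F \<subseteq> J" and W: "\<And>j. j \<in> F \<Longrightarrow> openin (X j) (W j)"
        "\<And>j. j \<in> F \<Longrightarrow> x j \<in> W j" "cylinder X J F W \<subseteq> V"
      using V by (rule nbhd_of_product_topologyE) blast
    have nbhd: "nbhd_of (X j) (x j) (W j)" if "j \<in> F" for j
      using W(1,2)[OF that] by (rule openin_imp_nbhd_of)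
    have "\<exists>N. (\<forall>j\<in>F. N j \<in> \<N> j \<and> x j \<in> N j \<and> N j \<subseteq> W j) \<and> infinite (cylinder X J F N \<inter> A)"
      by (rule cp_network_at_cylinder_accumulation[OF x t1 _ _ A F])
        (erule cp count nbhd)+
    then obtain N where N: "\<forall>j\<in>F. N j \<in> \<N> j \<and> x j \<in> N j \<and> N j \<subseteq> W j" "infinite (cylinder X J F N \<inter> A)"
      by (elim exE conjE)
    show ?thesis
    proof (intro bexI conjI)
      show "cylinder X J F N \<in> cylinders X J \<N>"
        using N(1) by (intro cylinder_in_cylinders F) simp
      show "x \<in> cylinder X J F N"
        using x N(1) by (simp add: cylinder_def)
      show "cylinder X J F N \<subseteq> V"
        using cylinder_mono[of F N W X J] N(1) W(3) by blast
    qed (rule N(2))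
  qed
  then show ?thesis
    using False unfolding cp_network_at_def by blast
qed

text \<open>Every neighbourhood contains a basic open cylinder, so the factors' properties are
  invoked only at its finitely many coordinates. The hypotheses \<open>t1\<close> and
  \<open>count\<close> serve the case \<open>CP\<close>.\<close>

lemma kind_network_at_product_topology:
  assumes net: "\<And>j. j \<in> J \<Longrightarrow> kind_network_at k (X j) (\<N> j) (x j)"
    and x: "x \<in> topspace (product_topology X J)" and t1: "t1_space (product_topology X J)"
    and count: "\<And>j. j \<in> J \<Longrightarrow> countable {N \<in> \<N> j. x j \<in> N}"
  shows "kind_network_at k (product_topology X J) (cylinders X J \<N>) x"
proof (cases k)
  case CK
  have "\<exists>U. nbhd_of (product_topology X J) x U \<and>
      (\<forall>K. compactin (product_topology X J) K \<and> K \<subseteq> U \<longrightarrow>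
        (\<exists>\<F>. finite \<F> \<and> \<F> \<subseteq> cylinders X J \<N> \<and> x \<in> \<Inter>\<F> \<and> K \<subseteq> \<Union>\<F> \<and> \<Union>\<F> \<subseteq> V))"
    if V: "nbhd_of (product_topology X J) x V" for V
  proof -
    obtain F W where F: "finite F" "F \<subseteq> J" and W: "\<And>j. j \<in> F \<Longrightarrow> openin (X j) (W j)"
        "\<And>j. j \<in> F \<Longrightarrow> x j \<in> W j" "cylinder X J F W \<subseteq> V"
      using V by (rule nbhd_of_product_topologyE) blast
    have "\<forall>j\<in>F. \<exists>U. nbhd_of (X j) (x j) U \<and> (\<forall>K. compactin (X j) K \<and> K \<subseteq> U \<longrightarrow>
        (\<exists>\<F>. finite \<F> \<and> \<F> \<subseteq> \<N> j \<and> x j \<in> \<Inter>\<F> \<and> K \<subseteq> \<Union>\<F> \<and> \<Union>\<F> \<subseteq> W j))"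
    proof
      fix j assume j: "j \<in> F"
      have ck: "ck_network_at (X j) (\<N> j) (x j)"
        using net[of j] j F(2) CK by auto
      show "\<exists>U. nbhd_of (X j) (x j) U \<and> (\<forall>K. compactin (X j) K \<and> K \<subseteq> U \<longrightarrow>
          (\<exists>\<F>. finite \<F> \<and> \<F> \<subseteq> \<N> j \<and> x j \<in> \<Inter>\<F> \<and> K \<subseteq> \<Union>\<F> \<and> \<Union>\<F> \<subseteq> W j))"
        using ck[unfolded ck_network_at_def, rule_format, OF openin_imp_nbhd_of[OF W(1,2)[OF j]]] .
    qed
    from bchoice[OF this] obtain U
      where U: "\<forall>j\<in>F. nbhd_of (X j) (x j) (U j) \<and> (\<forall>K. compactin (X j) K \<and> K \<subseteq> U j \<longrightarrow>
        (\<exists>\<F>. finite \<F> \<and> \<F> \<subseteq> \<N> j \<and> x j \<in> \<Inter>\<F> \<and> K \<subseteq> \<Union>\<F> \<and> \<Union>\<F> \<subseteq> W j))" ..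
    show ?thesis
    proof (intro exI[of _ "cylinder X J F U"] conjI allI impI)
      show "nbhd_of (product_topology X J) x (cylinder X J F U)"
        using U by (intro nbhd_of_cylinder x F) simp
      fix K assume K: "compactin (product_topology X J) K \<and> K \<subseteq> cylinder X J F U"
      \<comment> \<open>Projections of \<open>K\<close> are compact, so each factor can cover its
        own projection.\<close>
      have "\<forall>j\<in>F. \<exists>\<F>. finite \<F> \<and> \<F> \<subseteq> \<N> j \<and> x j \<in> \<Inter>\<F> \<and> (\<lambda>f. f j) ` K \<subseteq> \<Union>\<F> \<and> \<Union>\<F> \<subseteq> W j"
      proof
        fix j assume j: "j \<in> F"
        then have "continuous_map (product_topology X J) (X j) (\<lambda>f. f j)"
          using F(2) by (intro continuous_map_product_projection) auto
        then have "compactin (X j) ((\<lambda>f. f j) ` K)"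
          using K by (blast intro: image_compactin)
        moreover have "(\<lambda>f. f j) ` K \<subseteq> U j"
          using K j by (auto simp: cylinder_def)
        ultimately show "\<exists>\<F>. finite \<F> \<and> \<F> \<subseteq> \<N> j \<and> x j \<in> \<Inter>\<F> \<and> (\<lambda>f. f j) ` K \<subseteq> \<Union>\<F> \<and> \<Union>\<F> \<subseteq> W j"
          using U[rule_format, OF j] by simp
      qed
      from bchoice[OF this] obtain \<F> where \<F>: "\<forall>j\<in>F. finite (\<F> j) \<and> \<F> j \<subseteq> \<N> j \<and> x j \<in> \<Inter>(\<F> j) \<and>
          (\<lambda>f. f j) ` K \<subseteq> \<Union>(\<F> j) \<and> \<Union>(\<F> j) \<subseteq> W j" ..
      show "\<exists>\<F>. finite \<F> \<and> \<F> \<subseteq> cylinders X J \<N> \<and> x \<in> \<Inter>\<F> \<and> K \<subseteq> \<Union>\<F> \<and> \<Union>\<F> \<subseteq> V"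
      \<comment> \<open>All combinations are taken, since different points of \<open>K\<close> may
        use different members at each coordinate; every combination contains \<open>x\<close>
        because every chosen member contains \<open>x j\<close>.\<close>
      proof (intro exI[of _ "cylinder X J F ` Pi\<^sub>E F \<F>"] conjI)
        show "finite (cylinder X J F ` Pi\<^sub>E F \<F>)"
          using F(1) \<F> by (intro finite_imageI finite_PiE) auto
        show "cylinder X J F ` Pi\<^sub>E F \<F> \<subseteq> cylinders X J \<N>"
        proof (rule image_subsetI)
          fix N assume "N \<in> Pi\<^sub>E F \<F>"
          then have "N j \<in> \<N> j" if "j \<in> F" for j
            using \<F> PiE_mem that by blast
          then show "cylinder X J F N \<in> cylinders X J \<N>"
            by (rule cylinder_in_cylinders[OF F])
        qed
        show "x \<in> \<Inter>(cylinder X J F ` Pi\<^sub>E F \<F>)"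
          using x \<F> by (auto simp: cylinder_def PiE_iff simp del: topspace_product_topology)
        show "K \<subseteq> \<Union>(cylinder X J F ` Pi\<^sub>E F \<F>)"
        proof
          fix f assume f: "f \<in> K"
          have "\<forall>j\<in>F. \<exists>N. N \<in> \<F> j \<and> f j \<in> N"
            using f \<F> by blast
          from bchoice[OF this] obtain N where N: "\<forall>j\<in>F. N j \<in> \<F> j \<and> f j \<in> N j" ..
          have "f \<in> cylinder X J F (restrict N F)"
            using f K N by (auto simp: cylinder_def simp del: topspace_product_topology)
          moreover have "restrict N F \<in> Pi\<^sub>E F \<F>"
            using N by auto
          ultimately show "f \<in> \<Union>(cylinder X J F ` Pi\<^sub>E F \<F>)"
            by blast
        qed
        have "cylinder X J F N \<subseteq> cylinder X J F W" if N: "N \<in> Pi\<^sub>E F \<F>" for N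
        proof (rule cylinder_mono)
          fix j assume j: "j \<in> F"
          then have "N j \<in> \<F> j" "\<Union>(\<F> j) \<subseteq> W j"
            using N \<F> by (simp_all add: PiE_mem)
          then show "N j \<subseteq> W j"
            by (rule order_trans[OF Union_upper])
        qed
        then show "\<Union>(cylinder X J F ` Pi\<^sub>E F \<F>) \<subseteq> V"
          using W(3) by blast
      qed
    qed
  qed
  then show ?thesis
    by (simp add: CK ck_network_at_def)
next
  case CS
  have "\<exists>N\<in>cylinders X J \<N>. \<exists>k. {x} \<union> {s n |n. n \<ge> k} \<subseteq> N \<and> N \<subseteq> V"
    if s: "range s \<subseteq> topspace (product_topology X J)" "limitin (product_topology X J) s x sequentially"
      and V: "nbhd_of (product_topology X J) x V" for s V
  proof -
    obtain F W where F: "finite F" "F \<subseteq> J" and W: "\<And>j. j \<in> F \<Longrightarrow> openin (X j) (W j)"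
        "\<And>j. j \<in> F \<Longrightarrow> x j \<in> W j" "cylinder X J F W \<subseteq> V"
      using V by (rule nbhd_of_product_topologyE) blast
    have "\<forall>j\<in>F. \<exists>N. N \<in> \<N> j \<and> x j \<in> N \<and> N \<subseteq> W j \<and> (\<forall>\<^sub>F n in sequentially. s n j \<in> N)"
    proof
      fix j assume j: "j \<in> F"
      then have "cs_network_at (X j) (\<N> j) (x j)"
        using net[of j] F(2) CS by auto
      moreover have "range (\<lambda>n. s n j) \<subseteq> topspace (X j)"
        using s(1) j F(2) by fastforce
      moreover have "limitin (X j) (\<lambda>n. s n j) (x j) sequentially"
        using s(2) j F(2) by (auto simp: limitin_componentwise)
      moreover have "nbhd_of (X j) (x j) (W j)"
        using W(1,2)[OF j] by (rule openin_imp_nbhd_of)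
      ultimately obtain N m where "N \<in> \<N> j" "x j \<in> N" "\<And>n. n \<ge> m \<Longrightarrow> s n j \<in> N" "N \<subseteq> W j"
        by (rule cs_network_atE) blast
      then show "\<exists>N. N \<in> \<N> j \<and> x j \<in> N \<and> N \<subseteq> W j \<and> (\<forall>\<^sub>F n in sequentially. s n j \<in> N)"
        unfolding eventually_sequentially by blast
    qed
    from bchoice[OF this] obtain N where N: "\<forall>j\<in>F. N j \<in> \<N> j \<and> x j \<in> N j \<and> N j \<subseteq> W j \<and>
        (\<forall>\<^sub>F n in sequentially. s n j \<in> N j)" ..
    \<comment> \<open>Finiteness of \<open>F\<close> gives a common starting index.\<close>
    then have "\<forall>\<^sub>F n in sequentially. \<forall>j\<in>F. s n j \<in> N j"
      using F(1) by (simp add: eventually_ball_finite)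
    then obtain m where "\<And>n j. n \<ge> m \<Longrightarrow> j \<in> F \<Longrightarrow> s n j \<in> N j"
      unfolding eventually_sequentially by blast
    then have "s n \<in> cylinder X J F N" if "n \<ge> m" for n
      using s(1) that unfolding cylinder_def by blast
    moreover have "x \<in> cylinder X J F N"
      using x N by (simp add: cylinder_def)
    moreover have "cylinder X J F N \<subseteq> V"
      using cylinder_mono[of F N W X J] N W(3) by blast
    moreover have "cylinder X J F N \<in> cylinders X J \<N>"
      using N by (intro cylinder_in_cylinders F) simp
    ultimately show ?thesis
      by (intro bexI[of _ "cylinder X J F N"] exI[of _ m]) auto
  qed
  then show ?thesis
    by (simp add: CS cs_network_at_def)
next
  case CS_star
  have "\<exists>N\<in>cylinders X J \<N>. x \<in> N \<and> N \<subseteq> V \<and> infinite {n. s n \<in> N}"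
    if s: "range s \<subseteq> topspace (product_topology X J)" "limitin (product_topology X J) s x sequentially"
      and V: "nbhd_of (product_topology X J) x V" for s :: "nat \<Rightarrow> _" and V
  proof -
    obtain F W where F: "finite F" "F \<subseteq> J" and W: "\<And>j. j \<in> F \<Longrightarrow> openin (X j) (W j)"
        "\<And>j. j \<in> F \<Longrightarrow> x j \<in> W j" "cylinder X J F W \<subseteq> V"
      using V by (rule nbhd_of_product_topologyE) blast
    have coords: "cs_star_network_at (X j) (\<N> j) (x j)" "range (\<lambda>n. s n j) \<subseteq> topspace (X j)"
        "limitin (X j) (\<lambda>n. s n j) (x j) sequentially" "nbhd_of (X j) (x j) (W j)" if j: "j \<in> F" for j
    proof -
      show "cs_star_network_at (X j) (\<N> j) (x j)"
        using net[of j] j F(2) CS_star by auto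
      show "range (\<lambda>n. s n j) \<subseteq> topspace (X j)"
        using s(1) j F(2) by fastforce
      show "limitin (X j) (\<lambda>n. s n j) (x j) sequentially"
        using s(2) j F(2) by (auto simp: limitin_componentwise)
      show "nbhd_of (X j) (x j) (W j)"
        using W(1,2)[OF j] by (rule openin_imp_nbhd_of)
    qed
    have "\<exists>N r. strict_mono (r :: nat \<Rightarrow> nat) \<and>
        (\<forall>j\<in>F. N j \<in> \<N> j \<and> x j \<in> N j \<and> N j \<subseteq> W j \<and> (\<forall>n. s (r n) j \<in> N j))"
      by (rule cs_star_network_at_simultaneous_subsequence[OF F(1)]) (erule coords)+
    then obtain N and r :: "nat \<Rightarrow> nat" where r: "strict_mono r"
      and N: "\<forall>j\<in>F. N j \<in> \<N> j \<and> x j \<in> N j \<and> N j \<subseteq> W j \<and> (\<forall>n. s (r n) j \<in> N j)"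
      by (elim exE conjE)
    have "s (r n) \<in> cylinder X J F N" for n
      using s(1) N unfolding cylinder_def by blast
    then have "range r \<subseteq> {n. s n \<in> cylinder X J F N}"
      by auto
    moreover have "infinite (range r)"
      using r strict_mono_imp_inj_on range_inj_infinite by blast
    ultimately have "infinite {n. s n \<in> cylinder X J F N}"
      using finite_subset by blast
    moreover have "x \<in> cylinder X J F N"
      using x N by (simp add: cylinder_def)
    moreover have "cylinder X J F N \<subseteq> V"
      using cylinder_mono[of F N W X J] N W(3) by blast
    moreover have "cylinder X J F N \<in> cylinders X J \<N>"
      using N by (intro cylinder_in_cylinders F) simp
    ultimately show ?thesis
      by blast
  qed
  then show ?thesis
    by (simp add: CS_star cs_star_network_at_def)
next
  case CP
  then show ?thesis
    using cp_network_at_product_topology[OF x t1 _ count] net by simp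
next
  case CN
  have "nbhd_of (product_topology X J) x (\<Union>{N \<in> cylinders X J \<N>. x \<in> N \<and> N \<subseteq> V})"
    if V: "nbhd_of (product_topology X J) x V" for V
  proof -
    obtain F W where F: "finite F" "F \<subseteq> J" and W: "\<And>j. j \<in> F \<Longrightarrow> openin (X j) (W j)"
        "\<And>j. j \<in> F \<Longrightarrow> x j \<in> W j" "cylinder X J F W \<subseteq> V"
      using V by (rule nbhd_of_product_topologyE) blast
    define M where "M j = \<Union>{N \<in> \<N> j. x j \<in> N \<and> N \<subseteq> W j}" for j
    have "nbhd_of (X j) (x j) (M j)" if "j \<in> F" for j
      using net[of j] F(2) that openin_imp_nbhd_of[OF W(1,2)[OF that]]
      by (auto simp: CN cn_network_at_def M_def)
    then have "nbhd_of (product_topology X J) x (cylinder X J F M)"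
      by (rule nbhd_of_cylinder[OF x F])
    then show ?thesis
    proof (rule nbhd_of_mono)
      \<comment> \<open>Each coordinate of a point \<open>f\<close> selects its own member through
        \<open>x j\<close>; the cylinder over these selections contains both \<open>x\<close> and
        \<open>f\<close>.\<close>
      show "cylinder X J F M \<subseteq> \<Union>{N \<in> cylinders X J \<N>. x \<in> N \<and> N \<subseteq> V}"
      proof
        fix f assume f: "f \<in> cylinder X J F M"
        then have "\<forall>j\<in>F. \<exists>N. N \<in> \<N> j \<and> x j \<in> N \<and> N \<subseteq> W j \<and> f j \<in> N"
          by (auto simp: cylinder_def M_def)
        from bchoice[OF this]
        obtain N where N: "\<forall>j\<in>F. N j \<in> \<N> j \<and> x j \<in> N j \<and> N j \<subseteq> W j \<and> f j \<in> N j" ..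
        have "cylinder X J F N \<in> cylinders X J \<N>"
          using N by (intro cylinder_in_cylinders F) simp
        moreover have "x \<in> cylinder X J F N" "f \<in> cylinder X J F N"
          using x f N by (simp_all add: cylinder_def)
        moreover have "cylinder X J F N \<subseteq> V"
          using cylinder_mono[of F N W X J] N W(3) by blast
        ultimately show "f \<in> \<Union>{N \<in> cylinders X J \<N>. x \<in> N \<and> N \<subseteq> V}"
          by blast
      qed
      show "\<Union>{N \<in> cylinders X J \<N>. x \<in> N \<and> N \<subseteq> V} \<subseteq> topspace (product_topology X J)"
        using V unfolding nbhd_of_alt by blast
    qed
  qed
  then show ?thesis
    by (simp add: CN cn_network_at_def)
next
  case Zero
  have "\<exists>N\<in>cylinders X J \<N>. x \<in> N \<and> N \<subseteq> V" if V: "nbhd_of (product_topology X J) x V" for V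
  proof -
    obtain F W where F: "finite F" "F \<subseteq> J" and W: "\<And>j. j \<in> F \<Longrightarrow> openin (X j) (W j)"
        "\<And>j. j \<in> F \<Longrightarrow> x j \<in> W j" "cylinder X J F W \<subseteq> V"
      using V by (rule nbhd_of_product_topologyE) blast
    have "\<forall>j\<in>F. \<exists>N. N \<in> \<N> j \<and> x j \<in> N \<and> N \<subseteq> W j"
    proof
      fix j assume j: "j \<in> F"
      then have "network_at (X j) (\<N> j) (x j)"
        using net[of j] F(2) Zero by auto
      then show "\<exists>N. N \<in> \<N> j \<and> x j \<in> N \<and> N \<subseteq> W j"
        using openin_imp_nbhd_of[OF W(1,2)[OF j]] unfolding network_at_def by blast
    qed
    from bchoice[OF this] obtain N where N: "\<forall>j\<in>F. N j \<in> \<N> j \<and> x j \<in> N j \<and> N j \<subseteq> W j" ..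
    have "cylinder X J F N \<in> cylinders X J \<N>"
      using N by (intro cylinder_in_cylinders F) simp
    moreover have "x \<in> cylinder X J F N"
      using x N by (simp add: cylinder_def)
    moreover have "cylinder X J F N \<subseteq> V"
      using cylinder_mono[of F N W X J] N W(3) by blast
    ultimately show ?thesis
      by blast
  qed
  then show ?thesis
    by (simp add: Zero network_at_def)
qed

section \<open>Countable products and the three closure properties together\<close>

lemma kind_sigma_space_product_topology:
  fixes X :: "'j \<Rightarrow> 'c topology"
  assumes "countable J" "\<And>j. j \<in> J \<Longrightarrow> kind_sigma_space k (X j)"
  shows "kind_sigma_space k (product_topology X J)"
proof -
  have "\<forall>j\<in>J. \<exists>\<A> :: nat \<Rightarrow> 'c set set. (\<forall>n. locally_finite_in (X j) (\<A> n)) \<and>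
      kind_network_in k (X j) (\<Union>n. \<A> n)"
    using assms(2) unfolding kind_sigma_space_def sigma_locally_finite_in_def by blast
  \<comment> \<open>Choosing levels, not just networks, provides the indices from which the
    countable decomposition of the cylinders is built.\<close>
  then obtain \<A> :: "'j \<Rightarrow> nat \<Rightarrow> 'c set set"
    where \<A>: "\<And>j n. j \<in> J \<Longrightarrow> locally_finite_in (X j) (\<A> j n)"
      "\<And>j. j \<in> J \<Longrightarrow> kind_network_in k (X j) (\<Union>n. \<A> j n)"
    by metis
  have Hausdorff: "Hausdorff_space (product_topology X J)"
    using assms(2) by (simp add: Hausdorff_space_product_topology kind_sigma_space_def)
  have regular: "regular_space (product_topology X J)"
    using assms(2) by (simp add: regular_space_product_topology kind_sigma_space_def)
  have "kind_network_in k (product_topology X J) (cylinders X J (\<lambda>j. \<Union>n. \<A> j n))"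
    unfolding kind_network_in_def
  proof (intro conjI ballI)
    show "cylinders X J (\<lambda>j. \<Union>n. \<A> j n) \<subseteq> Pow (topspace (product_topology X J))"
      using cylinder_subset_topspace unfolding cylinders_def by blast
    fix x assume x: "x \<in> topspace (product_topology X J)"
    have xj: "x j \<in> topspace (X j)" if "j \<in> J" for j
      using x that by auto
    show "kind_network_at k (product_topology X J) (cylinders X J (\<lambda>j. \<Union>n. \<A> j n)) x"
    proof (rule kind_network_at_product_topology)
      fix j assume j: "j \<in> J"
      show "kind_network_at k (X j) (\<Union>n. \<A> j n) (x j)"
        using \<A>(2)[OF j] xj[OF j] unfolding kind_network_in_def by blast
      have "sigma_locally_finite_in (X j) (\<Union>n. \<A> j n)"
        using \<A>(1)[OF j] by (intro sigma_locally_finite_in_UN) auto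
      then show "countable {N \<in> \<Union>n. \<A> j n. x j \<in> N}"
        using xj[OF j] by (rule sigma_locally_finite_in_countable_at)
    qed (use x Hausdorff Hausdorff_imp_t1_space in auto)
  qed
  moreover have "sigma_locally_finite_in (product_topology X J) (cylinders X J (\<lambda>j. \<Union>n. \<A> j n))"
    using assms(1) \<A>(1) by (rule sigma_locally_finite_in_cylinders)
  ultimately show ?thesis
    using Hausdorff regular unfolding kind_sigma_space_def by blast
qed

theorem corollary5p6:
  fixes \<nn> :: network_kind
  shows "(\<forall>(X :: 'a topology) S.
            kind_sigma_space \<nn> X \<and> S \<subseteq> topspace X
              \<longrightarrow> kind_sigma_space \<nn> (subtopology X S))
       \<and> (\<forall>(X :: 'i \<Rightarrow> 'b topology) I.
            (\<forall>i\<in>I. kind_sigma_space \<nn> (X i))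
              \<longrightarrow> kind_sigma_space \<nn> (sum_topology X I))
       \<and> (\<forall>(X :: 'j \<Rightarrow> 'c topology) J.
            countable J \<and> (\<forall>j\<in>J. kind_sigma_space \<nn> (X j))
              \<longrightarrow> kind_sigma_space \<nn> (product_topology X J))"
  by (intro conjI allI impI kind_sigma_space_subtopology kind_sigma_space_sum_topology
      kind_sigma_space_product_topology) auto

end
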